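(* Every nowhere dense graph class has almost bounded merge-width.
   Context: Graphs are finite, simple and undirected: $G=(V,E(G))$ with $E(G)\subseteq\binom V2$. A graph class $\mathcal C$ is nowhere dense if for every $r\in\mathbb N$ there is $k\in\mathbb N$ such that the $r$-subdivision of the $k$-clique (obtained by replacing each of its edges with a path with $r$ inner vertices) is not a subgraph of any graph in $\mathcal C$. Merge-width. A construction sequence on $V$ is a sequence of steps maintaining a partition $\mathcal P$ of $V$ and a partition of $\binom V2$ into edges $E$, non-edges $N$, and unresolved pairs $U$. Initially $\mathcal P$ is the partition into singletons and $U=\binom V2$. In each step one of three operations is performed: merge two parts $A,B\in\mathcal P$, replacing them by $A\cup B$; resolve positively a pair of parts $A,B\in\mathcal P$ (possibly $A=B$), moving all $\{a,b\}\in U$ with $a\in A,b\in B$ from $U$ to $E$; or resolve negatively such a pair of parts, moving these pairs from $U$ to $N$. In the end $\mathcal P$ has one part and $U=\emptyset$; it is then a construction sequence of the graph $(V,E)$. Its radius-$r$ width is the least $k$ such that at every step, for every $v\in V$, at most $k$ parts of the current $\mathcal P$ contain a vertex reachable from $v$ by a path of length at most $r$ in the graph $(V,E\cup N)$ for the current $E,N$. The radius-$r$ merge-width $\mathrm{mw}_r(G)$ is the least radius-$r$ width of a construction sequence of $G$. A graph class $\mathcal C$ has almost bounded merge-width if for every $r\in\mathbb N$ and $\varepsilon>0$ we have $\mathrm{mw}_r(G)\le O_{\mathcal C,r,\varepsilon}(|V(G)|^{\varepsilon})$ for all $G\in\mathcal C$, where the constants hidden in $O_{\mathcal C,r,\varepsilon}(\cdot)$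 depend only on $\mathcal C,r,\varepsilon$. *)

theory Defs
  imports Complex_Main "HOL-Library.Ramsey"
begin

section \<open>Graphs\<close>

datatype 'a ugraph = Graph (verts: "'a set") (edges: "'a set set")

text \<open>The notation \<open>[V]\<^bsup>2\<^esup>\<close> from \<open>HOL-Library.Ramsey\<close> is the set of two-element subsets of \<open>V\<close>.\<close>

definition wf_ugraph :: "'a ugraph \<Rightarrow> bool" where
  "wf_ugraph G \<longleftrightarrow> finite (verts G) \<and> edges G \<subseteq> [verts G]\<^bsup>2\<^esup>"

definition graph_class :: "'a ugraph set \<Rightarrow> bool" where
  "graph_class C \<longleftrightarrow> (\<forall>G\<in>C. wf_ugraph G)"

text \<open>Subgraph containment up to isomorphism; the subgraph need not be induced.\<close>

definition contains_subgraph :: "'a ugraph \<Rightarrow> 'b ugraph \<Rightarrow> bool" where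
  "contains_subgraph G H \<longleftrightarrow>
     (\<exists>f. inj_on f (verts H) \<and> f ` verts H \<subseteq> verts G \<and> (\<forall>e\<in>edges H. f ` e \<in> edges G))"


section \<open>Nowhere dense classes\<close>

definition clique_graph :: "nat \<Rightarrow> nat ugraph" where
  "clique_graph k = Graph {..<k} ([{..<k}]\<^bsup>2\<^esup>)"

text \<open>
  In a subdivision, \<open>Inl v\<close> is the original vertex \<open>v\<close>, and \<open>Inr (u, v, t)\<close> with \<open>u < v\<close>
  and \<open>1 \<le> t \<le> r\<close> is the \<open>t\<close>-th inner vertex of the path replacing the edge \<open>{u, v}\<close>.
  The linear order serves only to choose a direction for each edge. The path replacing
  \<open>{u, v}\<close> is \<open>subdiv_vertex r u v 0, \<dots>, subdiv_vertex r u v (r + 1)\<close>.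
\<close>

definition subdiv_vertex :: "nat \<Rightarrow> 'a \<Rightarrow> 'a \<Rightarrow> nat \<Rightarrow> 'a + 'a \<times> 'a \<times> nat" where
  "subdiv_vertex r u v t =
     (if t = 0 then Inl u else if t = Suc r then Inl v else Inr (u, v, t))"

definition subdivision :: "nat \<Rightarrow> 'a::linorder ugraph \<Rightarrow> ('a + 'a \<times> 'a \<times> nat) ugraph" where
  "subdivision r G = Graph
     (Inl ` verts G \<union> {Inr (u, v, t) | u v t. u < v \<and> {u, v} \<in> edges G \<and> 1 \<le> t \<and> t \<le> r})
     {{subdiv_vertex r u v t, subdiv_vertex r u v (Suc t)} | u v t.
        u < v \<and> {u, v} \<in> edges G \<and> t \<le> r}"

definition nowhere_dense_class :: "'a ugraph set \<Rightarrow> bool" where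
  "nowhere_dense_class C \<longleftrightarrow>
     (\<forall>r. \<exists>k. \<forall>G\<in>C. \<not> contains_subgraph G (subdivision r (clique_graph k)))"


section \<open>Merge-width\<close>

datatype 'a cstate =
  CState (parts: "'a set set") (pos: "'a set set") (neg: "'a set set") (unres: "'a set set")

definition init_cstate :: "'a set \<Rightarrow> 'a cstate" where
  "init_cstate V = CState {{v} | v. v \<in> V} {} {} ([V]\<^bsup>2\<^esup>)"

text \<open>For overlapping \<open>A\<close> and \<open>B\<close> this contains singletons, but it is only used intersected
  with or subtracted from a set of unresolved pairs.\<close>

definition pairs_between :: "'a set \<Rightarrow> 'a set \<Rightarrow> 'a set set" where
  "pairs_between A B = {{a, b} | a b. a \<in> A \<and> b \<in> B}"

inductive cstep :: "'a cstate \<Rightarrow> 'a cstate \<Rightarrow> bool" where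
  merge: "\<lbrakk>A \<in> P; B \<in> P; A \<noteq> B\<rbrakk> \<Longrightarrow>
    cstep (CState P E N U) (CState (insert (A \<union> B) (P - {A, B})) E N U)"
| resolve_pos: "\<lbrakk>A \<in> P; B \<in> P\<rbrakk> \<Longrightarrow>
    cstep (CState P E N U)
          (CState P (E \<union> (U \<inter> pairs_between A B)) N (U - pairs_between A B))"
| resolve_neg: "\<lbrakk>A \<in> P; B \<in> P\<rbrakk> \<Longrightarrow>
    cstep (CState P E N U)
          (CState P E (N \<union> (U \<inter> pairs_between A B)) (U - pairs_between A B))"

text \<open>A construction sequence is represented by the list of states it passes through. A partition
  of a nonempty set has at least one part, so \<open>card (parts s) \<le> 1\<close> says that there is exactly one;
  the inequality only matters for the graph without vertices, whose partition has no part.\<close>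

definition construction_sequence :: "'a ugraph \<Rightarrow> 'a cstate list \<Rightarrow> bool" where
  "construction_sequence G ss \<longleftrightarrow>
     ss \<noteq> [] \<and> hd ss = init_cstate (verts G) \<and> successively cstep ss \<and>
     card (parts (last ss)) \<le> 1 \<and> unres (last ss) = {} \<and> pos (last ss) = edges G"

text \<open>Paths are lists of distinct vertices; their length is the number of edges.\<close>

definition path_in :: "'a ugraph \<Rightarrow> 'a list \<Rightarrow> bool" where
  "path_in G p \<longleftrightarrow> p \<noteq> [] \<and> distinct p \<and> set p \<subseteq> verts G \<and>
     successively (\<lambda>x y. {x, y} \<in> edges G) p"

definition reachable_within :: "'a ugraph \<Rightarrow> nat \<Rightarrow> 'a \<Rightarrow> 'a \<Rightarrow> bool" where
  "reachable_within G r u v \<longleftrightarrow>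
     (\<exists>p. path_in G p \<and> hd p = u \<and> last p = v \<and> length p - 1 \<le> r)"

definition reachable_parts :: "'a set \<Rightarrow> nat \<Rightarrow> 'a cstate \<Rightarrow> 'a \<Rightarrow> 'a set set" where
  "reachable_parts V r s v =
     {A \<in> parts s. \<exists>u\<in>A. reachable_within (Graph V (pos s \<union> neg s)) r v u}"

definition radius_width :: "nat \<Rightarrow> 'a ugraph \<Rightarrow> 'a cstate list \<Rightarrow> nat" where
  "radius_width r G ss =
     (LEAST k. \<forall>s\<in>set ss. \<forall>v\<in>verts G. card (reachable_parts (verts G) r s v) \<le> k)"

definition merge_width :: "nat \<Rightarrow> 'a ugraph \<Rightarrow> nat" where
  "merge_width r G = (LEAST k. \<exists>ss. construction_sequence G ss \<and> radius_width r G ss = k)"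

definition almost_bounded_merge_width :: "'a ugraph set \<Rightarrow> bool" where
  "almost_bounded_merge_width C \<longleftrightarrow>
     (\<forall>r. \<forall>\<epsilon>>0. \<exists>c::real. \<forall>G\<in>C.
        real (merge_width r G) \<le> c * real (card (verts G)) powr \<epsilon>)"

end

theory Submission
  imports Defs "HOL-Library.Disjoint_Sets"
begin

text \<open>
  A construction sequence is read off an ordering of the vertices. Let \<open>S\<close> run through the prefixes
  of the ordering, from the set \<open>V\<close> of all vertices down to the empty set. At the prefix \<open>S\<close>, the
  parts are the singletons of \<open>S\<close> and the classes of vertices outside \<open>S\<close> with equal neighbourhoods
  in \<open>S\<close>, and the edges outside \<open>S\<close> have been resolved. When \<open>x\<close> leaves the prefix, it is resolved
  positively with the classes of its neighbours, and then classes are merged. Non-edges are resolved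
  only at the very end, when there is a single part. At radius \<open>r\<close>, a vertex \<open>v\<close> reaches vertices
  outside \<open>S\<close>, and their neighbours in \<open>S\<close> belong to the set \<open>X\<close> of vertices at which paths of length
  at most \<open>r + 1\<close> from \<open>v\<close> first hit \<open>S\<close>. So the width is about the number of traces of
  neighbourhoods on \<open>X\<close>. A set of size \<open>t\<close> shattered by neighbourhoods of outside vertices yields a
  clique of size \<open>t\<close> subdivided once; hence in a nowhere dense class the number of traces is
  polynomial in \<open>card X\<close>, with an exponent that depends on the class only (\<open>card_traces_le\<close>,
  \<open>merge_width_le_of_ordering\<close>). It remains to find orderings for which \<open>X\<close> has size
  \<open>n powr \<epsilon>\<close>, where \<open>n = card V\<close>.

  The ordering is built from its end. Among the set \<open>S\<close> of vertices not yet placed, a vertex \<open>v\<close> is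
  chosen for which a small set \<open>H\<close> hits all short paths from \<open>v\<close> through \<open>V - S\<close> to the rest of
  \<open>S\<close>. Following paths from one hitting set to the next bounds \<open>card X\<close> by a power of \<open>card H\<close>
  (\<open>card_first_hits_le\<close>). If no vertex of \<open>S\<close> admits a small \<open>H\<close>, all of them have large fans of
  short paths, and these fans combine to a dense shallow topological minor
  (\<open>hitting_set_exists\<close>).

  Such minors do not exist by a density theorem (\<open>dense_graph_has_clique_minor\<close>): a graph with
  \<open>n powr (1 + \<epsilon>)\<close> edges contains a subdivision of a clique of any fixed size \<open>t\<close>, provided that \<open>n\<close>
  is large, with a bound on the lengths of the subdividing paths that depends on \<open>\<epsilon>\<close> but not on
  \<open>t\<close>. This independence is essential, because nowhere density provides the excluded clique size
  only after the length of the paths is known. To prove it, a set \<open>U\<close> of vertices is chosen that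
  maximises the number of its edges divided by \<open>card U powr (1 + 1 / k)\<close>. Balls in \<open>U\<close> of radius bounded
  in terms of \<open>\<epsilon>\<close> then contain nearly all of \<open>U\<close> on a logarithmic scale, even after the deletion of
  a few vertices. So among relatively few vertices there are always two that no small set
  separates at bounded distance. The graph of these robustly connected pairs has no large independent
  set, and dependent random choice finds \<open>t\<close> vertices in it that pairwise have many common
  neighbours. The paths of the subdivided clique can now be chosen greedily.

  The definition of nowhere density speaks of subdivisions in which all paths have the same length;
  Ramsey's theorem provides these (\<open>subdivided_clique_of_topo_minor\<close>).
\<close>

section \<open>Connections inside vertex sets\<close>

text \<open>
  The relation records the vertex set \<open>W\<close> that carries a connection and forgets the path itself.
  Lengths of paths become bounds on \<open>card W\<close>, disjointness of paths becomes disjointness of sets,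
  and concatenation becomes union.
\<close>

definition conn :: "'a set set \<Rightarrow> 'a set \<Rightarrow> 'a \<Rightarrow> 'a \<Rightarrow> bool" where
  "conn E W x y \<longleftrightarrow> x \<in> W \<and> (\<lambda>a b. a \<in> W \<and> b \<in> W \<and> {a, b} \<in> E)\<^sup>*\<^sup>* x y"

lemma conn_refl: "x \<in> W \<Longrightarrow> conn E W x x"
  by (simp add: conn_def)

lemma conn_in: "conn E W x y \<Longrightarrow> x \<in> W \<and> y \<in> W"
  unfolding conn_def by (metis (no_types, lifting) rtranclp.cases)

lemma conn_sym: "conn E W x y \<Longrightarrow> conn E W y x"
proof -
  assume a: "conn E W x y"
  have "symp (\<lambda>a b. a \<in> W \<and> b \<in> W \<and> {a, b} \<in> E)"
    by (auto simp: symp_def insert_commute)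
  then have "(\<lambda>a b. a \<in> W \<and> b \<in> W \<and> {a, b} \<in> E)\<^sup>*\<^sup>* y x"
    using a unfolding conn_def by (meson sympD symp_rtranclp)
  then show ?thesis
    using conn_in[OF a] by (simp add: conn_def)
qed

lemma conn_mono: "conn E W x y \<Longrightarrow> E \<subseteq> E' \<Longrightarrow> W \<subseteq> W' \<Longrightarrow> conn E' W' x y"
  unfolding conn_def by (auto elim!: rtranclp_mono[THEN predicate2D, rotated])

lemma conn_trans: "conn E W x y \<Longrightarrow> conn E W y z \<Longrightarrow> conn E W x z"
  unfolding conn_def by auto

lemma conn_union: "conn E W x y \<Longrightarrow> conn E W' y z \<Longrightarrow> conn E (W \<union> W') x z"
  by (rule conn_trans[of E "W \<union> W'" x y]; rule conn_mono[OF _ order_refl]) auto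

lemma conn_edge: "{x, y} \<in> E \<Longrightarrow> x \<in> W \<Longrightarrow> y \<in> W \<Longrightarrow> conn E W x y"
  unfolding conn_def by (auto intro: r_into_rtranclp)

lemma conn_of_walk:
  "p \<noteq> [] \<Longrightarrow> successively (\<lambda>x y. {x, y} \<in> E) p \<Longrightarrow> x \<in> set p \<Longrightarrow> conn E (set p) (hd p) x"
proof (induction p)
  case (Cons a p)
  show ?case
  proof (cases "x = a")
    case True
    then show ?thesis by (simp add: conn_refl)
  next
    case False
    then have p: "p \<noteq> []" "x \<in> set p"
      using Cons.prems by auto
    then have "conn E (set p) (hd p) x"
      using Cons by (auto simp: successively_Cons)
    moreover have "conn E {a, hd p} a (hd p)"
      using Cons.prems p by (intro conn_edge) (auto simp: successively_Cons)
    ultimately have "conn E ({a, hd p} \<union> set p) a x"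
      by (rule conn_union[rotated])
    moreover have "{a, hd p} \<union> set p = set (a # p)"
      using p by auto
    ultimately show ?thesis
      by simp
  qed
qed simp

lemma path_of_conn:
  assumes "conn E W x y"
  shows "\<exists>p. p \<noteq> [] \<and> hd p = x \<and> last p = y \<and> distinct p \<and> set p \<subseteq> W \<and>
             successively (\<lambda>x y. {x, y} \<in> E) p"
proof -
  have x: "x \<in> W"
    using assms by (simp add: conn_def)
  have "(\<lambda>a b. a \<in> W \<and> b \<in> W \<and> {a, b} \<in> E)\<^sup>*\<^sup>* x y"
    using assms by (simp add: conn_def)
  then show ?thesis
  proof (induction rule: rtranclp_induct)
    case base
    show ?case
      using x by (intro exI[of _ "[x]"]) auto
  next
    case (step y z)
    then obtain p where p: "p \<noteq> []" "hd p = x" "last p = y" "distinct p" "set p \<subseteq> W"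
      "successively (\<lambda>x y. {x, y} \<in> E) p"
      by blast
    show ?case
    proof (cases "z \<in> set p")
      case False
      then show ?thesis
        using p step by (intro exI[of _ "p @ [z]"]) (auto simp: successively_append_iff)
    next
      case True
      then obtain p1 p2 where "p = p1 @ z # p2"
        by (meson split_list)
      then show ?thesis
        using p by (intro exI[of _ "p1 @ [z]"])
          (auto simp: successively_append_iff successively_Cons hd_append split: if_splits)
    qed
  qed
qed

text \<open>
  A path into \<open>Z\<close> is cut off at its first vertex \<open>z\<close> in \<open>Z\<close>. The part \<open>P\<close> before \<open>z\<close> is
  returned separately and every vertex of it is connected to \<open>v\<close> inside \<open>P\<close>, so that two such
  parts that meet connect their starting points without using the end vertices.
\<close>

lemma conn_truncate:
  assumes "conn E Q v w" "v \<notin> Z" "w \<in> Z"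
  obtains P z where "P \<subseteq> Q - Z" "v \<in> P" "z \<in> Q \<inter> Z" "\<forall>x\<in>P. conn E P v x"
    "conn E (insert z P) v z"
proof -
  obtain p where p: "p \<noteq> []" "hd p = v" "last p = w" "set p \<subseteq> Q"
      "successively (\<lambda>x y. {x, y} \<in> E) p"
    using path_of_conn[OF assms(1)] by blast
  have "\<exists>x\<in>set p. x \<in> Z"
    using p assms by (metis last_in_set)
  then obtain ys z zs where s: "p = ys @ z # zs" "z \<in> Z" "\<forall>y\<in>set ys. y \<notin> Z"
    using split_list_first_prop[of p "\<lambda>x. x \<in> Z"] by blast
  have ys: "ys \<noteq> []"
    using s p assms by auto
  then have hd: "hd ys = v"
    using s p by simp
  have w: "successively (\<lambda>x y. {x, y} \<in> E) ys" "successively (\<lambda>x y. {x, y} \<in> E) (ys @ [z])"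
    using p(5) s(1) by (auto simp: successively_append_iff)
  show ?thesis
  proof (rule that[of "set ys" z])
    show "set ys \<subseteq> Q - Z" "v \<in> set ys" "z \<in> Q \<inter> Z"
      using s p ys hd by auto
    show "\<forall>x\<in>set ys. conn E (set ys) v x"
      using conn_of_walk[OF ys w(1)] hd by simp
    show "conn E (insert z (set ys)) v z"
      using conn_of_walk[OF _ w(2), of z] ys hd by simp
  qed
qed

section \<open>Degrees\<close>

definition induced :: "'a set set \<Rightarrow> 'a set \<Rightarrow> 'a set set" where
  "induced E W = {e \<in> E. e \<subseteq> W}"

definition nb :: "'a set set \<Rightarrow> 'a set \<Rightarrow> 'a \<Rightarrow> 'a set" where
  "nb E W v = {w \<in> W. {v, w} \<in> E}"

lemma finite_nb [simp]: "finite W \<Longrightarrow> finite (nb E W v)"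
  by (simp add: nb_def)

lemma nb_subset: "nb E W v \<subseteq> W"
  by (auto simp: nb_def)

lemma induced_mono: "W \<subseteq> W' \<Longrightarrow> induced E W \<subseteq> induced E W'"
  by (auto simp: induced_def)

lemma induced_self: "E \<subseteq> [V]\<^bsup>2\<^esup> \<Longrightarrow> induced E V = E"
  by (auto simp: induced_def nsets_def)

lemma finite_edges: "E \<subseteq> [V]\<^bsup>2\<^esup> \<Longrightarrow> finite V \<Longrightarrow> finite E"
  by (meson finite_imp_finite_nsets finite_subset)

lemma finite_induced: "E \<subseteq> [V]\<^bsup>2\<^esup> \<Longrightarrow> finite V \<Longrightarrow> finite (induced E W)"
  using finite_edges[of E V] by (simp add: induced_def)

lemma card_incident:
  assumes "E \<subseteq> [V]\<^bsup>2\<^esup>" "v \<in> W"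
  shows "card {e \<in> induced E W. v \<in> e} = card (nb E W v)"
proof -
  have "{e \<in> induced E W. v \<in> e} = (\<lambda>w. {v, w}) ` nb E W v"
  proof (intro equalityI subsetI)
    fix e assume e: "e \<in> {e \<in> induced E W. v \<in> e}"
    then have "e \<in> [V]\<^bsup>2\<^esup>"
      using assms by (auto simp: induced_def)
    then obtain x y where "e = {x, y}"
      by (elim nsets2_E) auto
    then show "e \<in> (\<lambda>w. {v, w}) ` nb E W v"
      using e by (auto simp: induced_def nb_def insert_commute)
  qed (use assms in \<open>auto simp: induced_def nb_def\<close>)
  moreover have "inj_on (\<lambda>w. {v, w}) (nb E W v)"
    by (auto simp: inj_on_def doubleton_eq_iff)
  ultimately show ?thesis
    by (simp add: card_image)
qed

text \<open>
  An edge meets \<open>B\<close> in at most two vertices, so it is counted at most twice.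
\<close>

lemma degree_sum_le:
  assumes E: "E \<subseteq> [V]\<^bsup>2\<^esup>" and fin: "finite V" and "B \<subseteq> W" "finite B"
  shows "(\<Sum>v\<in>B. card (nb E W v)) \<le> 2 * card {e \<in> induced E W. e \<inter> B \<noteq> {}}"
proof -
  let ?I = "{e \<in> induced E W. e \<inter> B \<noteq> {}}"
  have finI: "finite ?I"
    using finite_induced[OF E fin] by simp
  have "(\<Sum>v\<in>B. card (nb E W v)) = (\<Sum>v\<in>B. card {e \<in> ?I. v \<in> e})"
  proof (rule sum.cong)
    fix v assume v: "v \<in> B"
    then have "{e \<in> ?I. v \<in> e} = {e \<in> induced E W. v \<in> e}"
      by auto
    moreover have "v \<in> W"
      using v assms(3) by blast
    ultimately show "card (nb E W v) = card {e \<in> ?I. v \<in> e}"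
      by (simp only: card_incident[OF E])
  qed simp
  also have "\<dots> = (\<Sum>e\<in>?I. card {v \<in> B. v \<in> e})"
    using assms finI by (intro sum_multicount_gen) auto
  also have "\<dots> \<le> (\<Sum>e\<in>?I. 2)"
  proof (rule sum_mono)
    fix e assume "e \<in> ?I"
    then have "e \<in> [V]\<^bsup>2\<^esup>"
      using E by (auto simp: induced_def)
    then have "finite e" "card e = 2"
      by (auto simp: nsets_def)
    then show "card {v \<in> B. v \<in> e} \<le> 2"
      by (metis (no_types, lifting) card_mono mem_Collect_eq subsetI)
  qed
  finally show ?thesis
    by simp
qed

lemma degree_sum:
  assumes E: "E \<subseteq> [V]\<^bsup>2\<^esup>" and fin: "finite V" and "finite W"
  shows "(\<Sum>v\<in>W. card (nb E W v)) = 2 * card (induced E W)"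
proof -
  have "(\<Sum>v\<in>W. card (nb E W v)) = (\<Sum>v\<in>W. card {e \<in> induced E W. v \<in> e})"
    using card_incident[OF E] by (intro sum.cong) auto
  also have "\<dots> = 2 * card (induced E W)"
  proof (rule sum_multicount)
    show "\<forall>e\<in>induced E W. card {v \<in> W. v \<in> e} = 2"
    proof
      fix e assume e: "e \<in> induced E W"
      then have "{v \<in> W. v \<in> e} = e" "card e = 2"
        using E by (auto simp: induced_def nsets_def)
      then show "card {v \<in> W. v \<in> e} = 2"
        by simp
    qed
  qed (use assms finite_induced[OF E fin] in auto)
  finally show ?thesis .
qed

lemma card_induced_remove:
  assumes E: "E \<subseteq> [V]\<^bsup>2\<^esup>" and fin: "finite V" and "v \<in> W"
  shows "card (induced E W) = card (induced E (W - {v})) + card (nb E W v)"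
proof -
  have "induced E W = induced E (W - {v}) \<union> {e \<in> induced E W. v \<in> e}"
    by (auto simp: induced_def)
  moreover have "induced E (W - {v}) \<inter> {e \<in> induced E W. v \<in> e} = {}"
    by (auto simp: induced_def)
  ultimately have "card (induced E W) =
      card (induced E (W - {v})) + card {e \<in> induced E W. v \<in> e}"
    using finite_induced[OF E fin] by (metis card_Un_disjoint finite_Un)
  then show ?thesis
    using card_incident[OF E assms(3)] by simp
qed

text \<open>
  In a smallest nonempty subset of density at least \<open>d\<close>, deleting a vertex of degree below \<open>d\<close>
  would leave a smaller one.
\<close>

lemma min_degree_subset:
  assumes E: "E \<subseteq> [V]\<^bsup>2\<^esup>" and fin: "finite V" and W: "W \<subseteq> V" "W \<noteq> {}"
    and d: "d > 0" "d * card W \<le> card (induced E W)"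
  obtains U where "U \<subseteq> W" "U \<noteq> {}" "d * card U \<le> card (induced E U)"
    "\<forall>v\<in>U. d \<le> card (nb E U v)"
proof -
  let ?P = "\<lambda>U. U \<subseteq> W \<and> U \<noteq> {} \<and> d * card U \<le> card (induced E U)"
  obtain U where U: "?P U" and least: "\<And>U'. ?P U' \<Longrightarrow> card U \<le> card U'"
    using ex_has_least_nat[of ?P W card] W d by auto
  have "d \<le> card (nb E U v)" if v: "v \<in> U" for v
  proof (rule ccontr)
    assume small: "\<not> d \<le> card (nb E U v)"
    have finU: "finite U"
      using U W fin by (meson finite_subset)
    have c: "card U = Suc (card (U - {v}))"
      using card_Suc_Diff1[OF finU v] by simp
    have "d * card (U - {v}) < card (induced E (U - {v}))"
      using card_induced_remove[OF E fin v] U small c by simp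
    moreover have "U - {v} \<noteq> {}"
    proof
      assume "U - {v} = {}"
      then have "U = {v}"
        using v by blast
      then have "induced E U = {}"
        using E by (auto simp: induced_def nsets_def subset_singleton_iff)
      then show False
        using U d(1) c by simp
    qed
    ultimately have "card U \<le> card (U - {v})"
      using U by (intro least) auto
    then show False
      using c by simp
  qed
  then show ?thesis
    using that U by blast
qed

text \<open>
  A sparse graph has a vertex of degree less than \<open>2 * d\<close>. Putting it into the independent set
  costs at most \<open>2 * d\<close> vertices, namely itself and its neighbours.
\<close>

lemma independent_set_of_sparse:
  assumes E: "E \<subseteq> [V]\<^bsup>2\<^esup>" and fin: "finite V" and "W \<subseteq> V"
    and sparse: "\<And>U. U \<subseteq> W \<Longrightarrow> U \<noteq> {} \<Longrightarrow> card (induced E U) < d * card U"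
  obtains I where "I \<subseteq> W" "induced E I = {}" "card W \<le> 2 * d * card I"
proof -
  have "\<exists>I\<subseteq>W. induced E I = {} \<and> card W \<le> 2 * d * card I"
    using assms(3) sparse
  proof (induction "card W" arbitrary: W rule: less_induct)
    case less
    have finW: "finite W"
      using less.prems fin finite_subset by blast
    show ?case
    proof (cases "W = {}")
      case True
      have "induced E {} = {}"
        using E by (auto simp: induced_def nsets_def)
      then show ?thesis
        using True by auto
    next
      case False
      have "\<exists>v\<in>W. card (nb E W v) < 2 * d"
      proof (rule ccontr)
        assume "\<not> ?thesis"
        then have "(\<Sum>v\<in>W. 2 * d) \<le> (\<Sum>v\<in>W. card (nb E W v))"
          by (intro sum_mono) auto
        then show False
          using less.prems(2)[OF order_refl False] degree_sum[OF E fin finW] by (simp add: mult.commute)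
      qed
      then obtain v where v: "v \<in> W" "card (nb E W v) < 2 * d"
        by blast
      define W' where "W' = W - insert v (nb E W v)"
      have sub: "W' \<subseteq> W"
        by (auto simp: W'_def)
      have lt: "card W' < card W"
        using v finW by (intro psubset_card_mono) (auto simp: W'_def)
      obtain I where I: "I \<subseteq> W'" "induced E I = {}" "card W' \<le> 2 * d * card I"
        using less.hyps[OF lt] sub less.prems by (meson order_trans)
      have nb: "{v, w} \<notin> E \<and> {w, v} \<notin> E" if "w \<in> I" for w
        using that I(1) by (auto simp: W'_def nb_def insert_commute)
      have "induced E (insert v I) = {}"
      proof (rule ccontr)
        assume "induced E (insert v I) \<noteq> {}"
        then obtain e where e: "e \<in> E" "e \<subseteq> insert v I"
          by (auto simp: induced_def)
        then have "e \<in> [V]\<^bsup>2\<^esup>" using E by blast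
        then obtain x y where xy: "e = {x, y}" "x \<noteq> y"
          by (elim nsets2_E) auto
        have "x \<noteq> v" "y \<noteq> v"
          using e nb[of x] nb[of y] xy by auto
        then have "e \<subseteq> I"
          using e xy by auto
        then show False
          using e I(2) by (auto simp: induced_def)
      qed
      moreover have "card (insert v I) = Suc (card I)"
        using I(1) finW finite_subset[OF I(1)] by (subst card_insert_disjoint) (auto simp: W'_def)
      moreover have "card W \<le> card W' + card (insert v (nb E W v))"
        using finW by (subst card_Un_disjoint[symmetric]) (auto simp: W'_def intro!: card_mono)
      moreover have "card (insert v (nb E W v)) \<le> 2 * d"
        using v(2) finW by (simp add: card_insert_if)
      ultimately have "card W \<le> 2 * d * card (insert v I)"
        using I(3) by simp
      then show ?thesis
        using \<open>induced E (insert v I) = {}\<close> I(1) sub v by (intro exI[of _ "insert v I"]) auto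
    qed
  qed
  then show ?thesis
    using that by blast
qed

lemma dense_subset_of_no_independent:
  assumes E: "E \<subseteq> [V]\<^bsup>2\<^esup>" and fin: "finite V" and W: "W \<subseteq> V" "W \<noteq> {}"
    and d: "d > 0" "2 * d * a \<le> card W"
    and dep: "\<And>A. A \<subseteq> W \<Longrightarrow> card A = a \<Longrightarrow> induced E A \<noteq> {}"
  obtains U where "U \<subseteq> W" "U \<noteq> {}" "d * card U \<le> card (induced E U)"
    "\<forall>v\<in>U. d \<le> card (nb E U v)"
proof -
  have "\<exists>U\<subseteq>W. U \<noteq> {} \<and> d * card U \<le> card (induced E U)"
  proof (rule ccontr)
    assume neg: "\<not> ?thesis"
    have sparse: "card (induced E U) < d * card U" if "U \<subseteq> W" "U \<noteq> {}" for U
      using neg that not_le by blast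
    obtain I where I: "I \<subseteq> W" "induced E I = {}" "card W \<le> 2 * d * card I"
      by (rule independent_set_of_sparse[OF E fin W(1) sparse])
    then have "2 * d * a \<le> 2 * d * card I"
      using d by linarith
    then have "a \<le> card I"
      using d by simp
    then obtain A where A: "A \<subseteq> I" "card A = a"
      by (meson obtain_subset_with_card_n)
    then have "induced E A = {}"
      using I(2) induced_mono[of A I E] by blast
    then show False
      using dep[of A] A I(1) by blast
  qed
  then obtain U' where U': "U' \<subseteq> W" "U' \<noteq> {}" "d * card U' \<le> card (induced E U')"
    by blast
  show ?thesis
  proof (rule min_degree_subset[OF E fin order_trans[OF U'(1) W(1)] U'(2) d(1) U'(3)])
    fix U assume U: "U \<subseteq> U'" "U \<noteq> {}" "d * card U \<le> card (induced E U)"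
      "\<forall>v\<in>U. d \<le> card (nb E U v)"
    show thesis
      by (rule that[OF order_trans[OF U(1) U'(1)] U(2,3,4)])
  qed
qed

section \<open>Shallow topological minors\<close>

text \<open>
  The set \<open>I e\<close> carries the inner vertices of a path that replaces the edge \<open>e\<close>. It may contain
  further vertices; only its size matters.
\<close>

definition topo_model :: "nat \<Rightarrow> 'a set \<Rightarrow> 'a set set \<Rightarrow> 'a set \<Rightarrow> 'a set set \<Rightarrow> ('a set \<Rightarrow> 'a set) \<Rightarrow> bool"
  where "topo_model s V E A F I \<longleftrightarrow>
    (\<forall>e\<in>F. I e \<subseteq> V - A \<and> card (I e) \<le> s \<and> (\<forall>x\<in>e. \<forall>y\<in>e. conn E (I e \<union> e) x y)) \<and>
    (\<forall>e\<in>F. \<forall>f\<in>F. e \<noteq> f \<longrightarrow> I e \<inter> I f = {})"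

definition topo_minor :: "nat \<Rightarrow> 'a set \<Rightarrow> 'a set set \<Rightarrow> 'a set \<Rightarrow> 'a set set \<Rightarrow> bool" where
  "topo_minor s V E A F \<longleftrightarrow> A \<subseteq> V \<and> F \<subseteq> [A]\<^bsup>2\<^esup> \<and> (\<exists>I. topo_model s V E A F I)"

definition has_clique_minor :: "nat \<Rightarrow> nat \<Rightarrow> 'a set \<Rightarrow> 'a set set \<Rightarrow> bool" where
  "has_clique_minor s t V E \<longleftrightarrow> (\<exists>A. card A = t \<and> finite A \<and> topo_minor s V E A ([A]\<^bsup>2\<^esup>))"

lemma topo_minor_mono:
  assumes "topo_minor s V E A F" "s \<le> s'" "V \<subseteq> V'"
  shows "topo_minor s' V' E A F"
proof -
  obtain I where "topo_model s V E A F I"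
    using assms(1) by (auto simp: topo_minor_def)
  then have "topo_model s' V' E A F I"
    using assms(2,3) by (simp add: topo_model_def) (meson Diff_mono order_refl order_trans)
  then show ?thesis
    using assms unfolding topo_minor_def by blast
qed

lemma topo_model_insert:
  assumes model: "topo_model s V E A F I" and e: "e = {x, y}" "e \<notin> F"
    and J: "J \<subseteq> V - A" "card J \<le> s" "\<And>f. f \<in> F \<Longrightarrow> J \<inter> I f = {}" "conn E (J \<union> {x, y}) x y"
  shows "topo_model s V E A (insert e F) (I(e := J))"
  unfolding topo_model_def
proof (intro conjI ballI impI)
  fix f assume f: "f \<in> insert e F"
  show "(I(e := J)) f \<subseteq> V - A" "card ((I(e := J)) f) \<le> s"
    using f e J model by (auto simp: topo_model_def)
  fix p q assume pq: "p \<in> f" "q \<in> f"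
  show "conn E ((I(e := J)) f \<union> f) p q"
  proof (cases "f = e")
    case False
    then show ?thesis
      using f model pq by (simp add: topo_model_def)
  next
    case True
    then consider "p = q" "q \<in> {x, y}" | "p = x" "q = y" | "p = y" "q = x"
      using pq e by blast
    then have "conn E (J \<union> {x, y}) p q"
      using J(4) conn_sym[OF J(4)] by cases (auto intro: conn_refl)
    then show ?thesis
      using True e by simp
  qed
next
  fix f g assume fg: "f \<in> insert e F" "g \<in> insert e F" "f \<noteq> g"
  then consider "f \<in> F" "g \<in> F" "f \<noteq> e" "g \<noteq> e" | "f = e" "g \<in> F" "g \<noteq> e" | "f \<in> F" "g = e" "f \<noteq> e"
    using e(2) by blast
  then show "(I(e := J)) f \<inter> (I(e := J)) g = {}"
  proof cases
    case 1
    then show ?thesis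
      using model fg(3) by (simp add: topo_model_def)
  next
    case 2
    then show ?thesis
      using J(3) by simp
  next
    case 3
    then show ?thesis
      using J(3)[of f] by (simp add: Int_commute)
  qed
qed

lemma topo_minor_induced:
  assumes "topo_minor s V E A F" "B \<subseteq> A"
  shows "topo_minor s V E B (induced F B)"
proof -
  obtain I where I: "topo_model s V E A F I" and A: "A \<subseteq> V" "F \<subseteq> [A]\<^bsup>2\<^esup>"
    using assms(1) by (auto simp: topo_minor_def)
  have "topo_model s V E B (induced F B) I"
    unfolding topo_model_def
  proof (intro conjI ballI impI)
    fix e assume e: "e \<in> induced F B"
    then have eF: "e \<in> F"
      by (simp add: induced_def)
    then have "I e \<subseteq> V - A"
      using I by (simp add: topo_model_def)
    then show "I e \<subseteq> V - B"
      using assms(2) by blast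
    show "card (I e) \<le> s" "\<And>x y. x \<in> e \<Longrightarrow> y \<in> e \<Longrightarrow> conn E (I e \<union> e) x y"
      using I eF by (simp_all add: topo_model_def)
  next
    fix e f assume "e \<in> induced F B" "f \<in> induced F B" "e \<noteq> f"
    then show "I e \<inter> I f = {}"
      using I by (simp add: topo_model_def induced_def)
  qed
  moreover have "induced F B \<subseteq> [B]\<^bsup>2\<^esup>"
    using A(2) by (auto simp: induced_def nsets_def)
  ultimately show ?thesis
    using A assms(2) unfolding topo_minor_def by blast
qed

lemma conn_expand:
  assumes "conn F W x y"
    and "\<And>e x y. e \<in> F \<Longrightarrow> x \<in> e \<Longrightarrow> y \<in> e \<Longrightarrow> conn E (I e \<union> e) x y"
  shows "conn E (W \<union> (\<Union>e\<in>induced F W. I e)) x y"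
proof -
  have x: "x \<in> W" and r: "(\<lambda>a b. a \<in> W \<and> b \<in> W \<and> {a, b} \<in> F)\<^sup>*\<^sup>* x y"
    using assms(1) by (auto simp: conn_def)
  from r show ?thesis
  proof (induction rule: rtranclp_induct)
    case base
    then show ?case
      using x by (intro conn_refl) auto
  next
    case (step y z)
    have "conn E (I {y, z} \<union> {y, z}) y z"
      using step assms(2) by blast
    moreover have "I {y, z} \<union> {y, z} \<subseteq> W \<union> (\<Union>e\<in>induced F W. I e)"
      using step by (auto simp: induced_def)
    ultimately have "conn E (W \<union> (\<Union>e\<in>induced F W. I e)) y z"
      by (rule conn_mono[OF _ order_refl])
    then show ?case
      by (rule conn_trans[OF step.IH])
  qed
qed

text \<open>
  The path for an edge of \<open>K\<close> runs inside \<open>(A, F)\<close>, and all edges of \<open>F\<close> on its vertex set are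
  replaced by their paths in \<open>E\<close>. There are at most \<open>2 ^ (a + 2)\<close> such edges, a crude count
  that suffices because only the existence of a bound depending on \<open>a\<close> and \<open>b\<close> is needed later.
  Different edges of \<open>K\<close> use disjoint sets: an edge of \<open>F\<close> on both vertex sets would be equal to
  both.
\<close>

lemma topo_minor_compose:
  assumes "topo_minor b V E A F" "topo_minor a A F B K" and fin: "finite V"
  shows "topo_minor (a + 2 ^ (a + 2) * b) V E B K"
proof -
  obtain I where I: "topo_model b V E A F I" and AV: "A \<subseteq> V" and F: "F \<subseteq> [A]\<^bsup>2\<^esup>"
    using assms by (auto simp: topo_minor_def)
  obtain J where J: "topo_model a A F B K J" and BA: "B \<subseteq> A" and K: "K \<subseteq> [B]\<^bsup>2\<^esup>"
    using assms by (auto simp: topo_minor_def)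
  have finA: "finite A"
    using AV fin finite_subset by blast
  have I1: "I e \<subseteq> V - A" "card (I e) \<le> b" "x \<in> e \<Longrightarrow> y \<in> e \<Longrightarrow> conn E (I e \<union> e) x y" if "e \<in> F" for e x y
    using that I by (auto simp: topo_model_def)
  have I2: "I e \<inter> I f = {}" if "e \<in> F" "f \<in> F" "e \<noteq> f" for e f
    using that I by (auto simp: topo_model_def)
  have J1: "J k \<subseteq> A - B" "card (J k) \<le> a" "x \<in> k \<Longrightarrow> y \<in> k \<Longrightarrow> conn F (J k \<union> k) x y" if "k \<in> K" for k x y
    using that J by (auto simp: topo_model_def)
  have J2: "J e \<inter> J f = {}" if "e \<in> K" "f \<in> K" "e \<noteq> f" for e f
    using that J by (auto simp: topo_model_def)
  have k2: "finite k" "card k = 2" "k \<subseteq> B" if "k \<in> K" for k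
    using that K by (auto simp: nsets_def)
  have finJ: "finite (J k)" if "k \<in> K" for k
    using J1(1)[OF that] finA finite_subset by blast
  define L where "L k = J k \<union> (\<Union>e\<in>induced F (J k \<union> k). I e)" for k
  have Fi: "e \<in> F" if "e \<in> induced F W" for e W
    using that by (auto simp: induced_def)
  have "topo_model (a + 2 ^ (a + 2) * b) V E B K L"
    unfolding topo_model_def
  proof (intro conjI ballI impI)
    fix k assume k: "k \<in> K"
    show "L k \<subseteq> V - B"
      using J1(1)[OF k] I1(1)[OF Fi] AV BA unfolding L_def by blast
    have "card (J k \<union> k) \<le> a + 2"
      using J1(2)[OF k] k2[OF k] card_Un_le[of "J k" k] by linarith
    then have "card (Pow (J k \<union> k)) \<le> 2 ^ (a + 2)"
      using k2[OF k] finJ[OF k] power_increasing[of _ "a + 2" "2::nat"] by (simp add: card_Pow)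
    moreover have "card (induced F (J k \<union> k)) \<le> card (Pow (J k \<union> k))"
      using k2[OF k] finJ[OF k] by (intro card_mono) (auto simp: induced_def)
    ultimately have c: "card (induced F (J k \<union> k)) \<le> 2 ^ (a + 2)"
      by linarith
    have "card (\<Union>e\<in>induced F (J k \<union> k). I e) \<le> (\<Sum>e\<in>induced F (J k \<union> k). card (I e))"
      using finite_induced[OF F finA] by (rule card_UN_le)
    also have "\<dots> \<le> card (induced F (J k \<union> k)) * b"
      using sum_bounded_above[of "induced F (J k \<union> k)" "\<lambda>e. card (I e)" b] I1(2) Fi
      by auto
    also have "\<dots> \<le> 2 ^ (a + 2) * b"
      using c by simp
    finally show "card (L k) \<le> a + 2 ^ (a + 2) * b"
      using J1(2)[OF k] card_Un_le[of "J k" "\<Union>e\<in>induced F (J k \<union> k). I e"]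
      unfolding L_def by linarith
  next
    fix k x y assume k: "k \<in> K" and "x \<in> k" "y \<in> k"
    then have "conn E ((J k \<union> k) \<union> (\<Union>e\<in>induced F (J k \<union> k). I e)) x y"
      using J1(3) I1(3) by (intro conn_expand[of F]) auto
    moreover have "(J k \<union> k) \<union> (\<Union>e\<in>induced F (J k \<union> k). I e) = L k \<union> k"
      by (auto simp: L_def)
    ultimately show "conn E (L k \<union> k) x y"
      by simp
  next
    fix k l assume k: "k \<in> K" and l: "l \<in> K" and kl: "k \<noteq> l"
    show "L k \<inter> L l = {}"
    proof (rule ccontr)
      assume "L k \<inter> L l \<noteq> {}"
      then obtain v where v: "v \<in> L k" "v \<in> L l"
        by blast
      show False
      proof (cases "v \<in> A")
        case True
        then have "v \<in> J k \<inter> J l"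
          using v I1(1)[OF Fi] unfolding L_def by blast
        then show False
          using J2[OF k l kl] by blast
      next
        case False
        then obtain e f where ef: "e \<in> F" "e \<subseteq> J k \<union> k" "v \<in> I e" "f \<in> F" "f \<subseteq> J l \<union> l" "v \<in> I f"
          using v J1(1)[OF k] J1(1)[OF l] by (auto simp: L_def induced_def)
        then have "e = f"
          using I2 by blast
        then have sub: "e \<subseteq> k \<inter> l"
          using ef J1(1)[OF k] J1(1)[OF l] J2[OF k l kl] k2(3)[OF k] k2(3)[OF l] by blast
        have "card e = 2"
          using ef F by (auto simp: nsets_def)
        then have "e = k" "e = l"
          using sub k2[OF k] k2[OF l] card_subset_eq[of k e] card_subset_eq[of l e] by auto
        then show False
          using kl by simp
      qed
    qed
  qed
  then show ?thesis
    using AV BA K by (auto simp: topo_minor_def)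
qed

section \<open>Dense graphs contain shallow subdivisions of large cliques\<close>

lemma card_nsets_2_le: "finite A \<Longrightarrow> card ([A]\<^bsup>2\<^esup>) \<le> card A ^ 2"
  by (simp add: choose_two power2_eq_square) (metis diff_le_self div_le_dividend mult_le_mono2 order_trans)

text \<open>
  If two vertices of \<open>A\<close> remain connected by at most \<open>s\<close> vertices whatever set of the given size
  is deleted, the paths of the subdivided clique can be chosen one after another, each avoiding
  \<open>A\<close> and all paths chosen before.
\<close>

lemma topo_clique_greedy:
  assumes fin: "finite V" and A: "A \<subseteq> V" "card A = t"
    and link: "\<And>x y X. \<lbrakk>x \<in> A; y \<in> A; x \<noteq> y; X \<subseteq> V - {x, y}; card X \<le> t + t ^ 2 * s\<rbrakk>
      \<Longrightarrow> \<exists>W\<subseteq>V. W \<inter> X = {} \<and> card W \<le> s \<and> conn E W x y"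
  shows "topo_minor s V E A ([A]\<^bsup>2\<^esup>)"
proof -
  have finA: "finite A"
    using A(1) fin by (rule finite_subset)
  have "finite F \<Longrightarrow> F \<subseteq> [A]\<^bsup>2\<^esup> \<Longrightarrow> \<exists>I. topo_model s V E A F I" for F
  proof (induction F rule: finite_induct)
    case empty
    then show ?case
      by (simp add: topo_model_def)
  next
    case (insert e F)
    then obtain I where I: "topo_model s V E A F I"
      by auto
    have I1: "I f \<subseteq> V - A" "card (I f) \<le> s" if "f \<in> F" for f
      using that I by (auto simp: topo_model_def)
    have finI: "finite (I f)" if "f \<in> F" for f
      using I1(1)[OF that] fin by (meson Diff_subset finite_subset)
    obtain x y where e: "e = {x, y}" "x \<in> A" "y \<in> A" "x \<noteq> y"
      using insert.prems by (auto elim: nsets2_E)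
    define X where "X = (A \<union> (\<Union>f\<in>F. I f)) - {x, y}"
    have "card F \<le> t ^ 2"
      using insert.prems card_mono[of "[A]\<^bsup>2\<^esup>" F] card_nsets_2_le[OF finA] A(2) finA
      by (simp add: finite_imp_finite_nsets)
    then have "card (\<Union>f\<in>F. I f) \<le> t ^ 2 * s"
      using card_UN_le[OF insert.hyps(1), of I] sum_bounded_above[of F "\<lambda>f. card (I f)" s] I1(2)
      by (metis (no_types, lifting) mult_le_mono1 of_nat_id order_trans)
    moreover have "card X \<le> card (A \<union> (\<Union>f\<in>F. I f))"
      unfolding X_def using finA finI insert.hyps(1) by (intro card_mono) auto
    ultimately have "card X \<le> t + t ^ 2 * s"
      using card_Un_le[of A "\<Union>f\<in>F. I f"] A(2) by linarith
    moreover have "X \<subseteq> V - {x, y}"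
      using I1(1) A(1) by (auto simp: X_def)
    ultimately obtain W where W: "W \<subseteq> V" "W \<inter> X = {}" "card W \<le> s" "conn E W x y"
      using link[of x y X] e by blast
    have xy: "x \<in> W" "y \<in> W"
      using conn_in[OF W(4)] by auto
    have "topo_model s V E A (insert e F) (I(e := W - {x, y}))"
    proof (rule topo_model_insert[OF I e(1) insert.hyps(2)])
      show "W - {x, y} \<subseteq> V - A" "\<And>f. f \<in> F \<Longrightarrow> (W - {x, y}) \<inter> I f = {}"
        using W(1,2) by (auto simp: X_def)
      show "card (W - {x, y}) \<le> s"
        using W(3) card_mono[OF finite_subset[OF W(1) fin], of "W - {x, y}"] by force
      have "W - {x, y} \<union> {x, y} = W"
        using xy by blast
      then show "conn E (W - {x, y} \<union> {x, y}) x y"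
        using W(4) by simp
    qed
    then show ?case
      by blast
  qed
  then show ?thesis
    using A finA finite_imp_finite_nsets[OF finA, of 2] by (auto simp: topo_minor_def)
qed

section \<open>Growth of neighbourhoods\<close>

primrec nball :: "'a set set \<Rightarrow> 'a set \<Rightarrow> 'a \<Rightarrow> nat \<Rightarrow> 'a set" where
  "nball E W u 0 = {u}"
| "nball E W u (Suc n) = nball E W u n \<union> {w \<in> W. \<exists>x\<in>nball E W u n. {x, w} \<in> E}"

lemma nball_subset: "u \<in> W \<Longrightarrow> nball E W u n \<subseteq> W"
  by (induction n) auto

lemma nball_mono: "m \<le> n \<Longrightarrow> nball E W u m \<subseteq> nball E W u n"
  by (rule lift_Suc_mono_le) auto

lemma nball_center: "u \<in> nball E W u n"
  using nball_mono[of 0 n] by auto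

lemma nball_conn:
  assumes "u \<in> W" "w \<in> nball E W u n"
  shows "\<exists>Q\<subseteq>W. card Q \<le> Suc n \<and> conn E Q u w"
  using assms(2)
proof (induction n arbitrary: w)
  case 0
  then show ?case
    using assms(1) by (intro exI[of _ "{u}"]) (auto intro: conn_refl)
next
  case (Suc n)
  show ?case
  proof (cases "w \<in> nball E W u n")
    case True
    then show ?thesis
      using Suc.IH[OF True] le_SucI by blast
  next
    case False
    then obtain x where x: "x \<in> nball E W u n" "{x, w} \<in> E" "w \<in> W"
      using Suc.prems by auto
    obtain Q where Q: "Q \<subseteq> W" "card Q \<le> Suc n" "conn E Q u x"
      using Suc.IH[OF x(1)] by blast
    have "conn E {x, w} x w"
      using x by (intro conn_edge) auto
    then have "conn E (Q \<union> {x, w}) u w"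
      using conn_union[OF Q(3)] by blast
    moreover have "Q \<union> {x, w} = insert w Q"
      using conn_in[OF Q(3)] by auto
    moreover have "card (insert w Q) \<le> Suc (Suc n)"
      using Q(2) card_insert_le_m1[of "Suc (Suc n)" Q w] by simp
    ultimately show ?thesis
      using Q(1) x(3) by (intro exI[of _ "insert w Q"]) auto
  qed
qed

text \<open>
  Growth by more than the factor \<open>q\<close> in each of \<open>l\<close> rounds would exceed \<open>q ^ l\<close>.
\<close>

lemma nball_slow_growth:
  assumes "u \<in> W" "finite W" "card W \<le> q ^ l" "l > 0"
  shows "\<exists>i<l. card (nball E W u (Suc i)) \<le> q * card (nball E W u i)"
proof (rule ccontr)
  assume "\<not> ?thesis"
  then have grow: "q * card (nball E W u i) < card (nball E W u (Suc i))" if "i < l" for i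
    using that not_le by blast
  have "i < l \<Longrightarrow> q ^ Suc i < card (nball E W u (Suc i))" for i
  proof (induction i)
    case 0
    then show ?case
      using grow[of 0] by simp
  next
    case (Suc i)
    then have "q * q ^ Suc i \<le> q * card (nball E W u (Suc i))"
      by (intro mult_le_mono) auto
    also have "\<dots> < card (nball E W u (Suc (Suc i)))"
      by (rule grow[OF Suc.prems])
    finally show ?case
      by simp
  qed
  from this[of "l - 1"] have "q ^ l < card (nball E W u l)"
    using assms(4) by simp
  also have "\<dots> \<le> card W"
    using nball_subset[OF assms(1)] assms(2) by (rule card_mono[rotated])
  finally show False
    using assms(3) by simp
qed

text \<open>
  The hypothesis \<open>extremal\<close> says that \<open>U\<close> maximises \<open>e(U) ^ k / card U ^ (k + 1)\<close>, where \<open>e\<close>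
  counts induced edges: no subset is denser than \<open>U\<close> by more than the natural scaling of graphs
  with \<open>n ^ (1 + 1 / k)\<close> edges. Comparing \<open>U\<close> with \<open>U - {v}\<close> bounds the degree of \<open>v\<close> from
  below by the edge density of \<open>U\<close>.
\<close>

lemma extremal_min_degree:
  assumes E: "E \<subseteq> [V]\<^bsup>2\<^esup>" and fin: "finite V" and U: "U \<subseteq> V" and k: "k > 0"
    and extremal: "\<And>W. \<lbrakk>W \<subseteq> U; W \<noteq> {}\<rbrakk> \<Longrightarrow>
      card (induced E W) ^ k * card U ^ (k + 1) \<le> card (induced E U) ^ k * card W ^ (k + 1)"
    and v: "v \<in> U"
  shows "card (induced E U) \<le> card U * card (nb E U v)"
proof (cases "card (induced E U) = 0")
  case False
  define N m m' where "N = card U" and "m = card (induced E U)" and "m' = card (induced E (U - {v}))"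
  have finU: "finite U"
    using U fin by (rule finite_subset)
  have N: "card (U - {v}) = N - 1" "N > 0"
    using v finU by (auto simp: N_def card_gt_0_iff)
  have m: "m = m' + card (nb E U v)"
    using card_induced_remove[OF E fin v] by (simp add: m_def m'_def)
  have "U - {v} \<noteq> {}"
  proof
    assume "U - {v} = {}"
    then have "U = {v}"
      using v by blast
    then have "induced E U = {}"
      using E by (auto simp: induced_def nsets_def subset_singleton_iff)
    then show False
      using False by simp
  qed
  then have "m' ^ k * N ^ (k + 1) \<le> m ^ k * (N - 1) ^ (k + 1)"
    using extremal[of "U - {v}"] N(1) by (simp add: N_def m_def m'_def)
  also have "\<dots> \<le> m ^ k * ((N - 1) ^ k * N)"
    by simp
  finally have "m' ^ k * N ^ k * N \<le> m ^ k * (N - 1) ^ k * N"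
    by (simp add: mult.assoc mult.commute)
  then have "(m' * N) ^ k \<le> (m * (N - 1)) ^ k"
    using N(2) by (simp add: power_mult_distrib)
  then have "m' * N \<le> m * (N - 1)"
    using power_mono_iff[of "m' * N" "m * (N - 1)" k] k by simp
  also have "\<dots> = m * N - m"
    by (simp add: right_diff_distrib')
  finally have "m' * N \<le> m * N - m" .
  moreover have "m \<le> m * N"
    using N(2) by simp
  ultimately have "m' * N + m \<le> m * N"
    by linarith
  then have "m \<le> N * card (nb E U v)"
    using m by (simp add: algebra_simps)
  then show ?thesis
    by (simp add: N_def m_def)
qed simp

text \<open>
  Some ball \<open>B\<close> grows by a factor of at most \<open>q\<close> in the next step, to \<open>B'\<close> say. By the bound on
  degrees, \<open>B'\<close> contains a number of edges proportional to \<open>card B\<close> times the density of \<open>U\<close>,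
  hence it has at least a \<open>1 / (4 * q)\<close> fraction of the density of \<open>U\<close>. An extremal \<open>U\<close> tolerates
  this only if \<open>B'\<close> is not much smaller than \<open>U\<close>. Deleting the few vertices of \<open>X\<close> costs at most
  half of each degree.
\<close>

lemma extremal_large_balls:
  assumes E: "E \<subseteq> [V]\<^bsup>2\<^esup>" and fin: "finite V" and U: "U \<subseteq> V" and k: "k > 0"
    and extremal: "\<And>W. \<lbrakk>W \<subseteq> U; W \<noteq> {}\<rbrakk> \<Longrightarrow>
      card (induced E W) ^ k * card U ^ (k + 1) \<le> card (induced E U) ^ k * card W ^ (k + 1)"
    and pos: "card (induced E U) > 0"
    and l: "l > 0" "card U \<le> q ^ l"
    and X: "finite X" "2 * card U * card X \<le> card (induced E U)"
    and u: "u \<in> U - X"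
  shows "card U \<le> card (nball E (U - X) u l) * (4 * q) ^ k"
proof -
  define N m where "N = card U" and "m = card (induced E U)"
  have finU: "finite U"
    using U fin by (rule finite_subset)
  let ?B = "nball E (U - X) u"
  have B: "?B i \<subseteq> U - X" for i
    using u by (rule nball_subset)
  have finB: "finite (?B i)" for i
    using B finU by (meson Diff_subset finite_subset)
  have "card (U - X) \<le> q ^ l"
    using l(2) card_mono[of U "U - X"] finU by force
  then obtain i where i: "i < l" "card (?B (Suc i)) \<le> q * card (?B i)"
    using nball_slow_growth[of u "U - X" q l E] u l(1) finU by blast
  define b e where "b = card (?B (Suc i))" and "e = card (induced E (?B (Suc i)))"
  have deg: "m \<le> 2 * N * card (nb E (U - X) v)" if v: "v \<in> ?B i" for v
  proof -
    have "v \<in> U"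
      using v B by blast
    then have "2 * m \<le> 2 * N * card (nb E U v)"
      using extremal_min_degree[OF E fin U k extremal] by (simp add: m_def N_def)
    moreover have "nb E (U - X) v = nb E U v - X"
      by (auto simp: nb_def)
    then have "card (nb E U v) \<le> card (nb E (U - X) v) + card X"
      using diff_card_le_card_Diff[OF X(1), of "nb E U v"] by simp
    then have "2 * N * card (nb E U v) \<le> 2 * N * card (nb E (U - X) v) + 2 * N * card X"
      by (metis add_mult_distrib2 mult_le_mono2)
    ultimately show ?thesis
      using X(2) unfolding m_def N_def by linarith
  qed
  have inc: "{f \<in> induced E (U - X). f \<inter> ?B i \<noteq> {}} \<subseteq> induced E (?B (Suc i))"
  proof
    fix f assume f: "f \<in> {f \<in> induced E (U - X). f \<inter> ?B i \<noteq> {}}"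
    then have "f \<in> [V]\<^bsup>2\<^esup>"
      using E by (auto simp: induced_def)
    then obtain x y where "f = {x, y}"
      by (elim nsets2_E)
    then show "f \<in> induced E (?B (Suc i))"
      using f by (auto simp: induced_def insert_commute)
  qed
  have "card (?B i) * m \<le> (\<Sum>v\<in>?B i. 2 * N * card (nb E (U - X) v))"
    using sum_bounded_below[of "?B i" m] deg by simp
  also have "\<dots> = 2 * N * (\<Sum>v\<in>?B i. card (nb E (U - X) v))"
    by (simp add: sum_distrib_left)
  also have "\<dots> \<le> 2 * N * (2 * e)"
  proof -
    have "(\<Sum>v\<in>?B i. card (nb E (U - X) v)) \<le> 2 * card {f \<in> induced E (U - X). f \<inter> ?B i \<noteq> {}}"
      by (rule degree_sum_le[OF E fin B finB])
    moreover have "card {f \<in> induced E (U - X). f \<inter> ?B i \<noteq> {}} \<le> e"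
      unfolding e_def by (rule card_mono[OF finite_induced[OF E fin] inc])
    ultimately show ?thesis
      by (intro mult_le_mono2) linarith
  qed
  finally have "card (?B i) * m \<le> 4 * N * e"
    by simp
  moreover have "b * m \<le> q * (card (?B i) * m)"
    using mult_le_mono1[OF i(2), of m] by (simp add: b_def mult.assoc)
  \<comment> \<open>The lower bound on \<open>e\<close> is raised to the power \<open>k\<close> and played against extremality.\<close>
  ultimately have "b * m \<le> q * (4 * N * e)"
    by (meson mult_le_mono2 order_trans)
  then have "(b * m) ^ k * N \<le> (q * (4 * N * e)) ^ k * N"
    by (intro mult_le_mono1 power_mono) auto
  also have "\<dots> = (4 * q) ^ k * (e ^ k * N ^ (k + 1))"
    by (simp add: power_mult_distrib mult_ac)
  also have "\<dots> \<le> (4 * q) ^ k * (m ^ k * b ^ (k + 1))"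
  proof -
    have "?B (Suc i) \<subseteq> U" "?B (Suc i) \<noteq> {}"
      using B nball_center[of u E "U - X" "Suc i"] by blast+
    then show ?thesis
      using extremal unfolding e_def N_def m_def b_def by (intro mult_le_mono2) blast
  qed
  finally have "(b ^ k * m ^ k) * N \<le> (b ^ k * m ^ k) * (b * (4 * q) ^ k)"
    by (simp add: power_mult_distrib mult_ac)
  moreover have "b > 0"
    using finB[of "Suc i"] nball_center[of u E "U - X" "Suc i"] unfolding b_def card_gt_0_iff
    by blast
  ultimately have "N \<le> b * (4 * q) ^ k"
    using pos by (simp add: m_def)
  also have "b \<le> card (?B l)"
    unfolding b_def using i(1) by (intro card_mono finB nball_mono) auto
  finally show ?thesis
    by (simp add: N_def)
qed

section \<open>Robustly connected pairs\<close>

definition robust :: "'a set set \<Rightarrow> 'a set \<Rightarrow> nat \<Rightarrow> nat \<Rightarrow> 'a \<Rightarrow> 'a \<Rightarrow> bool" where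
  "robust E U R M x y \<longleftrightarrow>
    (\<forall>X. X \<subseteq> U - {x, y} \<and> card X \<le> M \<longrightarrow> (\<exists>W\<subseteq>U. W \<inter> X = {} \<and> card W \<le> R \<and> conn E W x y))"

lemma robust_sym:
  assumes "robust E U R M x y"
  shows "robust E U R M y x"
  unfolding robust_def
proof (intro allI impI)
  fix X assume "X \<subseteq> U - {y, x} \<and> card X \<le> M"
  then have "X \<subseteq> U - {x, y}" "card X \<le> M"
    by auto
  then obtain W where W: "W \<subseteq> U" "W \<inter> X = {}" "card W \<le> R" "conn E W x y"
    using assms unfolding robust_def by meson
  have "conn E W y x"
    using W(4) by (rule conn_sym)
  then show "\<exists>W\<subseteq>U. W \<inter> X = {} \<and> card W \<le> R \<and> conn E W y x"
    using W by blast
qed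

text \<open>
  Otherwise each pair in \<open>A\<close> has a separator of size at most \<open>M\<close>. After deleting all these
  separators, the balls of radius \<open>l\<close> around the vertices of \<open>A\<close> are disjoint, since two balls
  that meet give a short connection. But each ball contains a \<open>1 / (4 * q) ^ k\<close> fraction of \<open>U\<close>,
  and there are more than \<open>(4 * q) ^ k\<close> of them. The center of a ball is kept even when it belongs
  to a separator of other pairs.
\<close>

lemma robust_pair_exists:
  assumes E: "E \<subseteq> [V]\<^bsup>2\<^esup>" and fin: "finite V" and U: "U \<subseteq> V" and k: "k > 0"
    and extremal: "\<And>W. \<lbrakk>W \<subseteq> U; W \<noteq> {}\<rbrakk> \<Longrightarrow>
      card (induced E W) ^ k * card U ^ (k + 1) \<le> card (induced E U) ^ k * card W ^ (k + 1)"
    and pos: "card (induced E U) > 0"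
    and l: "l > 0" "card U \<le> q ^ l"
    and A: "A \<subseteq> U" "(4 * q) ^ k < card A"
    and M: "2 * card U * (card A ^ 2 * M) \<le> card (induced E U)"
  shows "\<exists>x\<in>A. \<exists>y\<in>A. x \<noteq> y \<and> robust E U (2 * l + 2) M x y"
proof (rule ccontr)
  assume neg: "\<not> ?thesis"
  have finU: "finite U"
    using U fin by (rule finite_subset)
  have finA: "finite A"
    using A(1) finU by (rule finite_subset)
  let ?sep = "\<lambda>x y X. (X \<subseteq> U - {x, y} \<and> card X \<le> M) \<and>
      \<not> (\<exists>W\<subseteq>U. W \<inter> X = {} \<and> card W \<le> 2 * l + 2 \<and> conn E W x y)"
  define Z where "Z x y = (SOME X. ?sep x y X)" for x y
  have sep: "?sep x y (Z x y)" if "x \<in> A" "y \<in> A" "x \<noteq> y" for x y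
  proof -
    have "\<not> robust E U (2 * l + 2) M x y"
      using neg that by blast
    then have "\<exists>X. ?sep x y X"
      by (simp only: robust_def not_all not_imp)
    then show ?thesis
      unfolding Z_def by (rule someI_ex)
  qed
  have Z: "Z x y \<subseteq> U - {x, y}" "card (Z x y) \<le> M" if "x \<in> A" "y \<in> A" "x \<noteq> y" for x y
    using sep[OF that] by (simp_all only:)
  let ?D = "{p \<in> A \<times> A. fst p \<noteq> snd p}"
  define X where "X = (\<Union>p\<in>?D. Z (fst p) (snd p))"
  have finD: "finite ?D"
    using finA by simp
  have XU: "X \<subseteq> U"
    using Z(1) unfolding X_def by fastforce
  then have finX: "finite X"
    using finU by (rule finite_subset)
  have "card X \<le> (\<Sum>p\<in>?D. card (Z (fst p) (snd p)))"
    unfolding X_def using finD by (rule card_UN_le)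
  also have "\<dots> \<le> card ?D * M"
    using sum_bounded_above[of ?D "\<lambda>p. card (Z (fst p) (snd p))" M] Z(2) by auto
  also have "\<dots> \<le> card (A \<times> A) * M"
    using finA by (intro mult_le_mono1 card_mono) auto
  finally have cX: "card X \<le> card A ^ 2 * M"
    by (simp add: power2_eq_square card_cartesian_product)
  let ?B = "\<lambda>u. nball E (U - (X - {u})) u l"
  have B: "?B u \<subseteq> U - (X - {u})" if "u \<in> A" for u
    using that A(1) by (intro nball_subset) auto
  have finB: "finite (?B u)" if "u \<in> A" for u
    using B[OF that] finU by (meson Diff_subset finite_subset)
  have big: "card U \<le> card (?B u) * (4 * q) ^ k" if u: "u \<in> A" for u
  proof (rule extremal_large_balls[OF E fin U k extremal pos l])
    have "card (X - {u}) \<le> card A ^ 2 * M"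
      using cX card_mono[OF finX, of "X - {u}"] by force
    then have "2 * card U * card (X - {u}) \<le> 2 * card U * (card A ^ 2 * M)"
      by (rule mult_le_mono2)
    then show "2 * card U * card (X - {u}) \<le> card (induced E U)"
      using M by linarith
  qed (use finX u A(1) in auto)
  have disj: "?B x \<inter> ?B y = {}" if xy: "x \<in> A" "y \<in> A" "x \<noteq> y" for x y
  proof (rule ccontr)
    assume "?B x \<inter> ?B y \<noteq> {}"
    then obtain z where z: "z \<in> ?B x" "z \<in> ?B y"
      by blast
    obtain P where P: "P \<subseteq> U - (X - {x})" "card P \<le> Suc l" "conn E P x z"
      using nball_conn[OF _ z(1)] xy A(1) by blast
    obtain Q where Q: "Q \<subseteq> U - (X - {y})" "card Q \<le> Suc l" "conn E Q y z"
      using nball_conn[OF _ z(2)] xy A(1) by blast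
    have "conn E (P \<union> Q) x y"
      using conn_union[OF P(3) conn_sym[OF Q(3)]] .
    moreover have "Z x y \<subseteq> X"
      using xy by (force simp: X_def)
    then have "(P \<union> Q) \<inter> Z x y = {}"
      using P(1) Q(1) Z(1)[OF xy] by blast
    moreover have "card (P \<union> Q) \<le> 2 * l + 2"
      using card_Un_le[of P Q] P(2) Q(2) by linarith
    moreover have "P \<union> Q \<subseteq> U"
      using P(1) Q(1) by blast
    ultimately show False
      using sep[OF xy] by blast
  qed
  have "card A * card U \<le> (\<Sum>u\<in>A. card (?B u) * (4 * q) ^ k)"
    using sum_bounded_below[of A "card U"] big by simp
  also have "\<dots> = (\<Sum>u\<in>A. card (?B u)) * (4 * q) ^ k"
    by (simp add: sum_distrib_right)
  also have "(\<Sum>u\<in>A. card (?B u)) = card (\<Union>u\<in>A. ?B u)"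
    using finA finB disj by (intro card_UN_disjoint[symmetric]) auto
  also have "card (\<Union>u\<in>A. ?B u) \<le> card U"
    using B by (intro card_mono finU) blast
  finally have "card A * card U \<le> card U * (4 * q) ^ k"
    by simp
  moreover have "card U > 0"
    using A finU by (metis card.empty card_gt_0_iff gr_implies_not_zero subset_empty)
  ultimately show False
    using A(2) by simp
qed

section \<open>Many common neighbours\<close>

text \<open>
  A form of dependent random choice. Call a pair bad if it has fewer than \<open>c\<close> common neighbours.
  A graph without large independent sets contains a set \<open>W\<close> of large minimum degree. If no set of
  \<open>t\<close> vertices is free of bad pairs, then the bad pairs, too, form a graph without large
  independent sets, so the neighbourhood of every vertex of \<open>W\<close> contains many bad pairs. This
  contradicts the double counting of pairs of a bad pair and a common neighbour.
\<close>

lemma pairwise_common_neighbours: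
  assumes R: "R \<subseteq> [U]\<^bsup>2\<^esup>" and fin: "finite U" and "U \<noteq> {}"
    and dep: "\<And>A. A \<subseteq> U \<Longrightarrow> card A = a \<Longrightarrow> induced R A \<noteq> {}"
    and d: "d' > 0" "2 * d' * a \<le> card U" "d > 0" "2 * d * t \<le> d'" "c * card U < d ^ 2"
  shows "\<exists>A\<subseteq>U. card A = t \<and>
    (\<forall>x\<in>A. \<forall>y\<in>A. x \<noteq> y \<longrightarrow> c \<le> card {w \<in> U. {x, w} \<in> R \<and> {y, w} \<in> R})"
proof (rule ccontr)
  assume neg: "\<not> ?thesis"
  define B where "B = {e \<in> [U]\<^bsup>2\<^esup>. card {w \<in> U. \<forall>x\<in>e. {x, w} \<in> R} < c}"
  have BU: "B \<subseteq> [U]\<^bsup>2\<^esup>"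
    by (auto simp: B_def)
  have depB: "induced B A \<noteq> {}" if A: "A \<subseteq> U" "card A = t" for A
  proof -
    obtain x y where xy: "x \<in> A" "y \<in> A" "x \<noteq> y" "card {w \<in> U. {x, w} \<in> R \<and> {y, w} \<in> R} < c"
      using neg A not_le by blast
    then have "{x, y} \<in> induced B A"
      using A(1) by (auto simp: B_def induced_def)
    then show ?thesis
      by blast
  qed
  obtain W where W: "W \<subseteq> U" "W \<noteq> {}" "d' * card W \<le> card (induced R W)" and deg: "\<forall>v\<in>W. d' \<le> card (nb R W v)"
    by (rule dense_subset_of_no_independent[OF R fin order_refl \<open>U \<noteq> {}\<close> d(1,2) dep])
  have finW: "finite W"
    using W(1) fin by (rule finite_subset)
  have many_bad: "d ^ 2 \<le> card (induced B (nb R W w))" if w: "w \<in> W" for w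
  proof -
    have sub: "nb R W w \<subseteq> U"
      using W(1) nb_subset[of R W w] by blast
    have ne: "nb R W w \<noteq> {}"
      using bspec[OF deg w] d(1) by auto
    have "2 * d * t \<le> card (nb R W w)"
      using bspec[OF deg w] d(4) by simp
    then obtain U' where U': "U' \<subseteq> nb R W w" "U' \<noteq> {}" "d * card U' \<le> card (induced B U')"
        and deg': "\<forall>v\<in>U'. d \<le> card (nb B U' v)"
    proof (rule dense_subset_of_no_independent[OF BU fin sub ne d(3)])
      show "induced B A \<noteq> {}" if "A \<subseteq> nb R W w" "card A = t" for A
        using depB[of A] that sub by blast
    qed
    obtain v where "v \<in> U'"
      using U'(2) by blast
    have finU': "finite U'"
      using U'(1) finW by (meson finite_nb finite_subset)
    have "d \<le> card U'"
      using bspec[OF deg' \<open>v \<in> U'\<close>] card_mono[OF finU' nb_subset[of B U' v]] by simp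
    then have "d ^ 2 \<le> d * card U'"
      by (simp add: power2_eq_square)
    also have "\<dots> \<le> card (induced B (nb R W w))"
      using U'(3) card_mono[OF finite_induced[OF BU fin] induced_mono[OF U'(1)]] by (rule order_trans)
    finally show ?thesis .
  qed
  let ?BW = "induced B W"
  have finBW: "finite ?BW"
    by (rule finite_induced[OF BU fin])
  have eq: "induced B (nb R W w) = {e \<in> ?BW. \<forall>x\<in>e. {x, w} \<in> R}" for w
    by (auto simp: induced_def nb_def insert_commute)
  have "card W * d ^ 2 \<le> (\<Sum>w\<in>W. card (induced B (nb R W w)))"
    using sum_bounded_below[of W "d ^ 2"] many_bad by simp
  also have "\<dots> = (\<Sum>w\<in>W. card {e \<in> ?BW. \<forall>x\<in>e. {x, w} \<in> R})"
    by (simp only: eq)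
  also have "\<dots> = (\<Sum>e\<in>?BW. card {w \<in> W. \<forall>x\<in>e. {x, w} \<in> R})"
    using finW finBW by (intro sum_multicount_gen) auto
  also have "\<dots> \<le> (\<Sum>e\<in>?BW. c)"
  proof (rule sum_mono)
    fix e assume "e \<in> ?BW"
    then have "card {w \<in> U. \<forall>x\<in>e. {x, w} \<in> R} < c"
      by (auto simp: induced_def B_def)
    moreover have "card {w \<in> W. \<forall>x\<in>e. {x, w} \<in> R} \<le> card {w \<in> U. \<forall>x\<in>e. {x, w} \<in> R}"
      using fin W(1) by (intro card_mono) auto
    ultimately show "card {w \<in> W. \<forall>x\<in>e. {x, w} \<in> R} \<le> c"
      by linarith
  qed
  also have "\<dots> = card ?BW * c"
    by simp
  also have "\<dots> \<le> card W ^ 2 * c"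
  proof (rule mult_le_mono1)
    have "?BW \<subseteq> [W]\<^bsup>2\<^esup>"
      using BU by (auto simp: induced_def nsets_def)
    then show "card ?BW \<le> card W ^ 2"
      using card_mono[OF finite_imp_finite_nsets[OF finW]] card_nsets_2_le[OF finW] order_trans
      by blast
  qed
  finally have "card W * d ^ 2 \<le> card W * (card W * c)"
    by (simp add: power2_eq_square mult_ac)
  then have "d ^ 2 \<le> card W * c"
    using W(2) finW by (simp add: card_gt_0_iff)
  also have "\<dots> \<le> c * card U"
    using card_mono[OF fin W(1)] by simp
  finally show False
    using d(5) by simp
qed

section \<open>The density theorem\<close>

lemma extremal_subset_exists:
  fixes k :: nat
  assumes "finite V" "V \<noteq> {}"
  obtains U where "U \<subseteq> V" "U \<noteq> {}" "\<And>W. \<lbrakk>W \<subseteq> V; W \<noteq> {}\<rbrakk> \<Longrightarrow>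
      card (induced E W) ^ k * card U ^ (k + 1) \<le> card (induced E U) ^ k * card W ^ (k + 1)"
proof -
  let ?S = "{W. W \<subseteq> V \<and> W \<noteq> {}}"
  define f where "f W = real (card (induced E W)) ^ k / real (card W) ^ (k + 1)" for W
  have fin: "finite (f ` ?S)" and ne: "f ` ?S \<noteq> {}"
    using assms by auto
  obtain U where U: "U \<in> ?S" "Max (f ` ?S) = f U"
    using Max_in[OF fin ne] by (elim imageE)
  show ?thesis
  proof (rule that[of U])
    fix W assume W: "W \<subseteq> V" "W \<noteq> {}"
    have "f W \<le> f U"
      using Max_ge[OF fin] W U(2) by auto
    moreover have "card W > 0" "card U > 0"
      using W U(1) assms(1) by (auto simp: card_gt_0_iff intro: finite_subset)
    ultimately have "real (card (induced E W)) ^ k * real (card U) ^ (k + 1)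
        \<le> real (card (induced E U)) ^ k * real (card W) ^ (k + 1)"
      unfolding f_def by (subst (asm) frac_le_eq) (auto simp: field_simps)
    then have "real (card (induced E W) ^ k * card U ^ (k + 1))
        \<le> real (card (induced E U) ^ k * card W ^ (k + 1))"
      by simp
    then show "card (induced E W) ^ k * card U ^ (k + 1) \<le> card (induced E U) ^ k * card W ^ (k + 1)"
      by (simp only: of_nat_le_iff)
  qed (use U in auto)
qed

text \<open>
  The number of vertices will be at most \<open>q ^ dense_exp k\<close>. The factor \<open>2 * k + 2\<close> makes the density
  \<open>q ^ (2 * k + 2)\<close> of an extremal set exceed the square of the independence number
  \<open>(4 * q) ^ k\<close> by a factor of order \<open>q ^ 2\<close>.
\<close>

definition dense_exp :: "nat \<Rightarrow> nat" where
  "dense_exp k = k * (2 * k + 2)"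

text \<open>
  With \<open>card V\<close> close to \<open>q ^ dense_exp k\<close>, the density \<open>q ^ (4 * k + 4)\<close> is \<open>card V ^ (2 / k)\<close>.
  The depth of the clique minor depends on \<open>k\<close> alone; \<open>t\<close> only affects how large \<open>q\<close> must be.
\<close>

theorem dense_graph_has_clique_minor:
  fixes V :: "'a set"
  assumes k: "k > 0"
    and q: "q \<ge> 36 * (t + 1) ^ 2 * (t + t ^ 2 * (4 * dense_exp k + 4) + 1) * 25 ^ k"
    and E: "E \<subseteq> [V]\<^bsup>2\<^esup>" and fin: "finite V" and ne: "V \<noteq> {}"
    and size: "card V \<le> q ^ dense_exp k" and dense: "q ^ (4 * k + 4) * card V \<le> card E"
  shows "has_clique_minor (4 * dense_exp k + 4) t V E"
proof -
  define l s M where "l = dense_exp k" and "s = 4 * dense_exp k + 4"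
    and "M = t + t ^ 2 * (4 * dense_exp k + 4)"
  have l: "l > 0" "l = (2 * k + 2) * k"
    using k by (auto simp: l_def dense_exp_def)
  have q': "36 * (t + 1) ^ 2 * (M + 1) * 25 ^ k \<le> q"
    using q by (simp add: M_def)
  then have q0: "q > 0"
    by (metis add_gr_0 gr0I le_zero_eq mult_is_0 power_not_zero zero_less_one zero_neq_numeral not_gr_zero)
  have q2: "36 * (t + 1) ^ 2 * (M + 1) * 25 ^ k \<le> q ^ 2"
    using q' q0 by (metis power2_nat_le_imp_le le_square power2_eq_square order_trans)
  obtain U where U: "U \<subseteq> V" "U \<noteq> {}" and extr: "\<And>W. \<lbrakk>W \<subseteq> V; W \<noteq> {}\<rbrakk> \<Longrightarrow>
      card (induced E W) ^ k * card U ^ (k + 1) \<le> card (induced E U) ^ k * card W ^ (k + 1)"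
    using extremal_subset_exists[OF fin ne, of E k] by metis
  define N m where "N = card U" and "m = card (induced E U)"
  have finU: "finite U"
    using U(1) fin by (rule finite_subset)
  have N0: "N > 0"
    using U(2) finU by (simp add: N_def card_gt_0_iff)
  have n0: "card V > 0"
    using ne fin by (simp add: card_gt_0_iff)
  have Nn: "N \<le> card V"
    unfolding N_def by (rule card_mono[OF fin U(1)])
  \<comment> \<open>Comparing \<open>U\<close> with \<open>V\<close> shows that the extremal set is still dense.\<close>
  have m_ge: "q ^ (2 * k + 2) * N \<le> m"
  proof -
    have "(4 * k + 4) * k = 2 * l"
      by (simp add: l(2) algebra_simps)
    then have exps: "(q ^ (4 * k + 4)) ^ k = q ^ (2 * l)" "(q ^ (2 * k + 2)) ^ k = q ^ l"
      by (simp_all only: power_mult[symmetric] l(2))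
    have "(q ^ (4 * k + 4) * card V) ^ k * N ^ (k + 1) \<le> card E ^ k * N ^ (k + 1)"
      using dense by (intro mult_le_mono1 power_mono) auto
    also have "\<dots> \<le> m ^ k * card V ^ (k + 1)"
      using extr[OF order_refl ne] induced_self[OF E] by (simp add: N_def m_def)
    finally have "card V ^ k * (q ^ (2 * l) * N ^ (k + 1)) \<le> card V ^ k * (m ^ k * card V)"
      by (simp only: power_mult_distrib exps power_add[of "card V" k 1] power_one_right)
        (simp only: mult_ac)
    then have "q ^ (2 * l) * N ^ (k + 1) \<le> m ^ k * card V"
      using n0 by simp
    also have "\<dots> \<le> m ^ k * q ^ l"
      using size by (simp add: l_def)
    finally have "q ^ l * (q ^ l * N ^ (k + 1)) \<le> q ^ l * m ^ k"
      by (simp only: mult_2 power_add) (simp only: mult_ac)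
    then have "q ^ l * N ^ (k + 1) \<le> m ^ k"
      using q0 by simp
    moreover have "q ^ l * N ^ k \<le> q ^ l * N ^ (k + 1)"
      using N0 by simp
    ultimately have "(q ^ (2 * k + 2) * N) ^ k \<le> m ^ k"
      by (simp only: power_mult_distrib exps)
    then show ?thesis
      using power_mono_iff[of "q ^ (2 * k + 2) * N" m k] k by simp
  qed
  have m0: "m > 0"
    using m_ge q0 N0 by (metis gr0I le_zero_eq mult_is_0 power_not_zero not_gr_zero)
  have "m \<le> N ^ 2"
  proof -
    have "induced E U \<subseteq> [U]\<^bsup>2\<^esup>"
      using E by (auto simp: induced_def nsets_def)
    then show ?thesis
      unfolding m_def N_def
      using card_mono[OF finite_imp_finite_nsets[OF finU]] card_nsets_2_le[OF finU] order_trans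
      by blast
  qed
  then have N_ge: "q ^ (2 * k + 2) \<le> N"
    using m_ge N0 by (metis le_trans mult_le_cancel2 power2_eq_square)
  \<comment> \<open>By extremality every set of \<open>a\<close> vertices of \<open>U\<close> contains a robust pair.\<close>
  define a where "a = (4 * q) ^ k + 1"
  have a2: "a ^ 2 \<le> 25 ^ k * q ^ (2 * k)"
  proof -
    have "(4::nat) ^ k + 1 \<le> 5 ^ k"
      using power_strict_mono[of 4 "5::nat" k] k by simp
    then have "(4 ^ k + 1) * q ^ k \<le> 5 ^ k * q ^ k"
      by (rule mult_le_mono1)
    moreover have "1 \<le> q ^ k"
      using q0 by simp
    ultimately have "a \<le> 5 ^ k * q ^ k"
      unfolding a_def power_mult_distrib by (simp add: algebra_simps)
    then have "a ^ 2 \<le> (5 ^ k * q ^ k) ^ 2"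
      by (rule power_mono) simp
    also have "\<dots> = (5 ^ 2) ^ k * q ^ (2 * k)"
      by (simp only: power_mult_distrib power_mult[symmetric] mult.commute)
    finally show ?thesis
      by simp
  qed
  \<comment> \<open>The single inequality on which all later choices of constants rest.\<close>
  have budget: "36 * (t + 1) ^ 2 * (M + 1) * a ^ 2 \<le> q ^ (2 * k + 2)"
  proof -
    have "36 * (t + 1) ^ 2 * (M + 1) * a ^ 2 \<le> 36 * (t + 1) ^ 2 * (M + 1) * (25 ^ k * q ^ (2 * k))"
      using a2 by (rule mult_le_mono2)
    also have "\<dots> = (36 * (t + 1) ^ 2 * (M + 1) * 25 ^ k) * q ^ (2 * k)"
      by simp
    also have "\<dots> \<le> q ^ 2 * q ^ (2 * k)"
      using q2 by (rule mult_le_mono1)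
    finally show ?thesis
      by (simp only: power_add mult.commute[of "q ^ 2" "q ^ (2 * k)"])
  qed
  define R where "R = {e. \<exists>x\<in>U. \<exists>y\<in>U. e = {x, y} \<and> x \<noteq> y \<and> robust E U (2 * l + 2) M x y}"
  have RU: "R \<subseteq> [U]\<^bsup>2\<^esup>"
    by (auto simp: R_def)
  have Rrob: "robust E U (2 * l + 2) M x y" if "{x, y} \<in> R" for x y
    using that robust_sym by (fastforce simp: R_def doubleton_eq_iff)
  have dep: "induced R A \<noteq> {}" if A: "A \<subseteq> U" "card A = a" for A
  proof -
    have "2 * (a ^ 2 * M) \<le> 36 * (t + 1) ^ 2 * (M + 1) * a ^ 2"
    proof -
      have "2 * (a ^ 2 * M) \<le> 36 * ((M + 1) * a ^ 2)"
        by (simp add: algebra_simps)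
      also have "\<dots> \<le> (t + 1) ^ 2 * (36 * ((M + 1) * a ^ 2))"
        by simp
      finally show ?thesis
        by (simp only: mult_ac)
    qed
    then have "2 * (a ^ 2 * M) \<le> q ^ (2 * k + 2)"
      using budget by (rule order_trans)
    then have "2 * (a ^ 2 * M) * N \<le> m"
      using m_ge by (meson mult_le_mono1 order_trans)
    then have M': "2 * card U * (card A ^ 2 * M) \<le> card (induced E U)"
      by (simp only: A(2) m_def N_def mult_ac)
    have extr': "card (induced E W) ^ k * card U ^ (k + 1) \<le> card (induced E U) ^ k * card W ^ (k + 1)"
      if "W \<subseteq> U" "W \<noteq> {}" for W
      using that U(1) by (intro extr) auto
    have size': "card U \<le> q ^ l"
      using size Nn by (simp add: l_def N_def)
    have A': "(4 * q) ^ k < card A"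
      by (simp add: A(2) a_def)
    have pos: "0 < card (induced E U)"
      using m0 by (simp add: m_def)
    obtain x y where xy: "x \<in> A" "y \<in> A" "x \<noteq> y" "robust E U (2 * l + 2) M x y"
      using robust_pair_exists[OF E fin U(1) k extr' pos l(1) size' A(1) A' M'] by blast
    then have "{x, y} \<in> induced R A"
      using A(1) by (auto simp: R_def induced_def)
    then show ?thesis
      by blast
  qed
  \<comment> \<open>The largest \<open>d\<close> for which \<open>2 * d * (t + 1)\<close> is an admissible minimum degree in the graph of
    robust pairs; \<open>t + 1\<close> instead of \<open>t\<close> avoids division by zero.\<close>
  define d where "d = N div (4 * (t + 1) * a)"
  have a0: "a > 0"
    by (simp add: a_def)
  have d_big: "8 * (t + 1) * a * (M + 1) < d"
  proof -
    have "(t + 1) * a * 1 \<le> (t + 1) * a * ((t + 1) * a * (M + 1))"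
    proof (rule mult_le_mono2)
      have "1 * 1 * 1 \<le> (t + 1) * a * (M + 1)"
        using a0 by (intro mult_le_mono) auto
      then show "1 \<le> (t + 1) * a * (M + 1)"
        by simp
    qed
    then have small: "(t + 1) * a \<le> (t + 1) ^ 2 * (M + 1) * a ^ 2"
      by (simp only: power2_eq_square mult_ac mult_1_right)
    have "(8 * (t + 1) * a * (M + 1) + 1) * (4 * (t + 1) * a)
        = 32 * ((t + 1) ^ 2 * (M + 1) * a ^ 2) + 4 * ((t + 1) * a)"
      by (simp add: power2_eq_square algebra_simps)
    also have "\<dots> \<le> 36 * ((t + 1) ^ 2 * (M + 1) * a ^ 2)"
      using small by linarith
    also have "\<dots> = 36 * (t + 1) ^ 2 * (M + 1) * a ^ 2"
      by (simp only: mult.assoc)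
    also have "\<dots> \<le> N"
      using budget N_ge by (rule order_trans)
    finally have "8 * (t + 1) * a * (M + 1) + 1 \<le> d"
      unfolding d_def using a0 by (simp add: less_eq_div_iff_mult_less_eq)
    then show ?thesis
      by simp
  qed
  obtain A where A: "A \<subseteq> U" "card A = t" and common:
      "\<And>x y. \<lbrakk>x \<in> A; y \<in> A; x \<noteq> y\<rbrakk> \<Longrightarrow> M + 1 \<le> card {w \<in> U. {x, w} \<in> R \<and> {y, w} \<in> R}"
  proof -
    have d0: "d > 0"
      using d_big by simp
    have "4 * (t + 1) * a * d \<le> N"
      unfolding d_def by simp
    moreover have "2 * (2 * d * (t + 1)) * a = 4 * (t + 1) * a * d"
      by (simp add: algebra_simps)
    ultimately have d1: "2 * (2 * d * (t + 1)) * a \<le> card U"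
      by (simp only: N_def)
    have "N < 4 * (t + 1) * a * (d + 1)"
      unfolding d_def using dividend_less_times_div[of "4 * (t + 1) * a" N] a0
      by (simp only: distrib_left mult_1_right add.commute) simp
    also have "\<dots> \<le> 4 * (t + 1) * a * (2 * d)"
      using d0 by (intro mult_le_mono2) simp
    also have "\<dots> = 8 * (t + 1) * a * d"
      by simp
    finally have "(M + 1) * N \<le> (M + 1) * (8 * (t + 1) * a * d)"
      by (intro mult_le_mono2) (rule less_imp_le)
    also have "\<dots> = (8 * (t + 1) * a * (M + 1)) * d"
      by (simp only: mult_ac)
    also have "\<dots> < d * d"
      using d_big d0 by (intro mult_strict_right_mono) auto
    finally have "(M + 1) * card U < d ^ 2"
      by (simp add: power2_eq_square N_def)
    moreover have "0 < 2 * d * (t + 1)" "2 * d * t \<le> 2 * d * (t + 1)"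
      using d0 by simp_all
    ultimately have "\<exists>A\<subseteq>U. card A = t \<and>
      (\<forall>x\<in>A. \<forall>y\<in>A. x \<noteq> y \<longrightarrow> M + 1 \<le> card {w \<in> U. {x, w} \<in> R \<and> {y, w} \<in> R})"
      using pairwise_common_neighbours[OF RU finU U(2) dep _ d1 d0] by blast
    then show ?thesis
      using that by blast
  qed
  have "topo_minor s U E A ([A]\<^bsup>2\<^esup>)"
  proof (rule topo_clique_greedy[OF finU A])
    fix x y X
    assume xy: "x \<in> A" "y \<in> A" "x \<noteq> y" and X: "X \<subseteq> U - {x, y}" "card X \<le> t + t ^ 2 * s"
    have cX: "card X \<le> M"
      using X(2) by (simp add: M_def s_def)
    have "\<not> {w \<in> U. {x, w} \<in> R \<and> {y, w} \<in> R} \<subseteq> X"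
    proof
      assume "{w \<in> U. {x, w} \<in> R \<and> {y, w} \<in> R} \<subseteq> X"
      then have "card {w \<in> U. {x, w} \<in> R \<and> {y, w} \<in> R} \<le> card X"
        using X(1) finU by (meson Diff_subset card_mono finite_subset)
      then show False
        using common[OF xy] cX by simp
    qed
    then obtain w where w: "w \<in> U" "w \<notin> X" "{x, w} \<in> R" "{y, w} \<in> R"
      by blast
    have "X \<subseteq> U - {x, w}" "X \<subseteq> U - {y, w}"
      using X(1) w(2) by auto
    then obtain P Q where P: "P \<subseteq> U" "P \<inter> X = {}" "card P \<le> 2 * l + 2" "conn E P x w"
        and Q: "Q \<subseteq> U" "Q \<inter> X = {}" "card Q \<le> 2 * l + 2" "conn E Q y w"
      using Rrob[OF w(3)] Rrob[OF w(4)] cX unfolding robust_def by metis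
    have "conn E (P \<union> Q) x y"
      by (rule conn_union[OF P(4) conn_sym[OF Q(4)]])
    moreover have "card (P \<union> Q) \<le> s"
      using card_Un_le[of P Q] P(3) Q(3) by (simp add: s_def l_def)
    ultimately show "\<exists>W\<subseteq>U. W \<inter> X = {} \<and> card W \<le> s \<and> conn E W x y"
      using P(1,2) Q(1,2) by (intro exI[of _ "P \<union> Q"]) auto
  qed
  then have "topo_minor s V E A ([A]\<^bsup>2\<^esup>)"
    by (rule topo_minor_mono[OF _ order_refl U(1)])
  then show ?thesis
    using A finite_subset[OF A(1) finU] unfolding has_clique_minor_def s_def by blast
qed

section \<open>Fans and hitting sets\<close>

text \<open>
  The set \<open>W\<close> carries a path of fewer than \<open>m\<close> edges from \<open>v\<close> to another vertex of \<open>S\<close>, with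
  interior outside \<open>S\<close>.
\<close>

definition short_link :: "'a set set \<Rightarrow> 'a set \<Rightarrow> 'a set \<Rightarrow> nat \<Rightarrow> 'a \<Rightarrow> 'a set \<Rightarrow> bool" where
  "short_link E V S m v W \<longleftrightarrow>
    W \<subseteq> V \<and> card W \<le> m \<and> (\<exists>w. w \<noteq> v \<and> W \<inter> S = {v, w} \<and> conn E W v w)"

definition hits_links :: "'a set set \<Rightarrow> 'a set \<Rightarrow> 'a set \<Rightarrow> nat \<Rightarrow> 'a \<Rightarrow> 'a set \<Rightarrow> bool" where
  "hits_links E V S m v H \<longleftrightarrow> H \<subseteq> V - {v} \<and> (\<forall>W. short_link E V S m v W \<longrightarrow> H \<inter> W \<noteq> {})"

text \<open>
  Links that are disjoint apart from \<open>v\<close> are collected greedily: as long as there are fewer than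
  \<open>p\<close>, their vertices other than \<open>v\<close> do not hit all links.
\<close>

lemma fan_of_no_hitting_set:
  assumes fin: "finite V" and no: "\<And>H. card H \<le> p * m \<Longrightarrow> \<not> hits_links E V S m v H"
  shows "\<exists>\<Q>. finite \<Q> \<and> card \<Q> = p \<and> (\<forall>Q\<in>\<Q>. short_link E V S m v Q) \<and>
    (\<forall>Q\<in>\<Q>. \<forall>Q'\<in>\<Q>. Q \<noteq> Q' \<longrightarrow> Q \<inter> Q' = {v})"
proof -
  have "i \<le> p \<Longrightarrow> \<exists>\<Q>. finite \<Q> \<and> card \<Q> = i \<and> (\<forall>Q\<in>\<Q>. short_link E V S m v Q) \<and>
    (\<forall>Q\<in>\<Q>. \<forall>Q'\<in>\<Q>. Q \<noteq> Q' \<longrightarrow> Q \<inter> Q' = {v})" for i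
  proof (induction i)
    case 0
    then show ?case
      by (intro exI[of _ "{}"]) auto
  next
    case (Suc i)
    then obtain \<Q> where Q: "finite \<Q>" "card \<Q> = i" "\<forall>Q\<in>\<Q>. short_link E V S m v Q"
        "\<forall>Q\<in>\<Q>. \<forall>Q'\<in>\<Q>. Q \<noteq> Q' \<longrightarrow> Q \<inter> Q' = {v}"
      by auto
    define H where "H = \<Union>\<Q> - {v}"
    have QV: "Q \<subseteq> V" "card Q \<le> m" "v \<in> Q" if "Q \<in> \<Q>" for Q
      using Q(3) that by (auto simp: short_link_def)
    have "finite (\<Union>\<Q>)"
      using Q(1) QV(1) fin by (meson finite_Union finite_subset)
    then have "card H \<le> card (\<Union>\<Q>)"
      unfolding H_def by (intro card_mono) auto
    also have "\<dots> \<le> (\<Sum>Q\<in>\<Q>. card Q)"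
      using card_UN_le[OF Q(1), of "\<lambda>Q. Q"] by simp
    also have "\<dots> \<le> i * m"
      using sum_bounded_above[of \<Q> card m] QV(2) Q(2) by simp
    also have "\<dots> \<le> p * m"
      using Suc.prems by simp
    finally have "\<not> hits_links E V S m v H"
      by (rule no)
    moreover have "H \<subseteq> V - {v}"
      using QV(1) by (auto simp: H_def)
    ultimately obtain W where W: "short_link E V S m v W" "H \<inter> W = {}"
      unfolding hits_links_def by blast
    obtain w where w: "w \<in> W" "w \<noteq> v" "v \<in> W"
      using W(1) by (auto simp: short_link_def)
    have new: "W \<inter> Q = {v}" if "Q \<in> \<Q>" for Q
      using that W(2) w(3) QV(3)[OF that] by (auto simp: H_def)
    have "W \<notin> \<Q>"
      using new w by blast
    then show ?case
      using Q W(1) new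
      by (intro exI[of _ "insert W \<Q>"]) (auto simp: Int_commute)
  qed
  then show ?thesis
    by blast
qed

text \<open>
  Otherwise every vertex of \<open>S\<close> has a fan of \<open>p\<close> links. A maximal shallow topological minor
  \<open>(S, F)\<close> has few edges, so the set \<open>W\<close> of its inner vertices is small and \<open>F\<close> has a large
  independent set \<open>B\<close>. The links at vertices of \<open>B\<close> are cut off where they first meet \<open>S \<union> W\<close>.
  By maximality of \<open>F\<close> they do not end in \<open>B\<close>, and links at different vertices of \<open>B\<close> do not
  meet: either would yield a path that can be added to \<open>F\<close>. Thus they form a shallow topological
  minor on \<open>S \<union> W\<close> with \<open>p * card B\<close> edges, which is too dense.
\<close>

lemma hitting_set_exists:
  assumes fin: "finite V"
    and sparse: "\<And>A F. topo_minor (2 * m) V E A F \<Longrightarrow> A \<noteq> {} \<Longrightarrow> card F < D * card A"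
    and S: "S \<subseteq> V" "S \<noteq> {}"
  shows "\<exists>v\<in>S. \<exists>H. card H \<le> 2 * D * D * (1 + 2 * m * D) * m \<and> hits_links E V S m v H"
proof (rule ccontr)
  assume neg: "\<not> ?thesis"
  define p where "p = 2 * D * D * (1 + 2 * m * D)"
  have finS: "finite S"
    using S(1) fin by (rule finite_subset)
  have "\<exists>\<Q>. finite \<Q> \<and> card \<Q> = p \<and> (\<forall>Q\<in>\<Q>. short_link E V S m v Q) \<and>
    (\<forall>Q\<in>\<Q>. \<forall>Q'\<in>\<Q>. Q \<noteq> Q' \<longrightarrow> Q \<inter> Q' = {v})" if "v \<in> S" for v
    using neg that by (intro fan_of_no_hitting_set[OF fin]) (auto simp: p_def)
  then obtain fan where fan: "\<And>v. v \<in> S \<Longrightarrow> finite (fan v) \<and> card (fan v) = p \<and>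
      (\<forall>Q\<in>fan v. short_link E V S m v Q) \<and> (\<forall>Q\<in>fan v. \<forall>Q'\<in>fan v. Q \<noteq> Q' \<longrightarrow> Q \<inter> Q' = {v})"
    by metis

  let ?C = "{F. topo_minor (2 * m) V E S F}"
  have "?C \<subseteq> Pow ([S]\<^bsup>2\<^esup>)"
    by (auto simp: topo_minor_def)
  then have finC: "finite ?C"
    using finS by (simp add: finite_imp_finite_nsets finite_subset)
  have "{} \<in> ?C"
    using S(1) by (simp add: topo_minor_def topo_model_def)
  then obtain F where F: "F \<in> ?C" and max: "\<And>F'. F' \<in> ?C \<Longrightarrow> F \<subseteq> F' \<Longrightarrow> F' = F"
    using finite_has_maximal[OF finC] by blast
  have F2: "F \<subseteq> [S]\<^bsup>2\<^esup>" and Fm: "topo_minor (2 * m) V E S F"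
    using F by (auto simp: topo_minor_def)
  then obtain I where I: "topo_model (2 * m) V E S F I"
    by (auto simp: topo_minor_def)
  have I1: "I e \<subseteq> V - S" "card (I e) \<le> 2 * m" if "e \<in> F" for e
    using that I by (auto simp: topo_model_def)
  have finF: "finite F"
    using F2 finS by (rule finite_edges)
  define W where "W = (\<Union>e\<in>F. I e)"
  have W: "W \<subseteq> V - S"
    using I1(1) by (auto simp: W_def)
  have cF: "card F < D * card S"
    using sparse[OF Fm S(2)] .
  have "card W \<le> (\<Sum>e\<in>F. card (I e))"
    unfolding W_def using finF by (rule card_UN_le)
  also have "\<dots> \<le> card F * (2 * m)"
    using sum_bounded_above[of F "\<lambda>e. card (I e)" "2 * m"] I1(2) by simp
  also have "\<dots> \<le> D * card S * (2 * m)"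
    using cF by (intro mult_le_mono1) simp
  finally have cW: "card W \<le> 2 * m * D * card S"
    by (simp add: mult_ac)

  \<comment> \<open>Otherwise the edge could be added to the maximal set \<open>F\<close>.\<close>
  have joined: "{x, y} \<in> F"
    if xy: "x \<in> S" "y \<in> S" "x \<noteq> y" and J: "J \<subseteq> V - (S \<union> W)" "card J \<le> 2 * m" "conn E (J \<union> {x, y}) x y"
    for x y J
  proof (rule ccontr)
    assume notin: "{x, y} \<notin> F"
    have "topo_model (2 * m) V E S (insert {x, y} F) (I({x, y} := J))"
      using J by (intro topo_model_insert[OF I refl notin]) (auto simp: W_def)
    then have "insert {x, y} F \<in> ?C"
      using F2 xy S(1) unfolding topo_minor_def by auto
    then show False
      using max[of "insert {x, y} F"] notin by blast
  qed

  obtain B where B: "B \<subseteq> S" "induced F B = {}" "card S \<le> 2 * D * card B"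
  proof (rule independent_set_of_sparse[OF F2 finS order_refl])
    show "card (induced F U) < D * card U" if "U \<subseteq> S" "U \<noteq> {}" for U
      using sparse[OF topo_minor_induced[OF Fm that(1)] that(2)] .
  qed
  have finB: "finite B"
    using B(1) finS by (rule finite_subset)
  have indep: "{x, y} \<notin> F" if "x \<in> B" "y \<in> B" for x y
    using that B(2) by (auto simp: induced_def)

  let ?good = "\<lambda>v Q P z. P \<subseteq> Q - (S \<union> W - {v}) \<and> v \<in> P \<and> z \<in> Q \<inter> (S \<union> W - {v}) \<and>
    (\<forall>x\<in>P. conn E P v x) \<and> conn E (insert z P) v z"
  have "\<exists>r. ?good v Q (fst r) (snd r)" if v: "v \<in> B" and Q: "Q \<in> fan v" for v Q
  proof -
    have "short_link E V S m v Q"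
      using fan[of v] v B(1) Q by blast
    then obtain w where w: "w \<noteq> v" "Q \<inter> S = {v, w}" "conn E Q v w"
      by (auto simp: short_link_def)
    have "v \<notin> S \<union> W - {v}" "w \<in> S \<union> W - {v}"
      using w by auto
    then obtain P z where "P \<subseteq> Q - (S \<union> W - {v})" "v \<in> P" "z \<in> Q \<inter> (S \<union> W - {v})"
        "\<forall>x\<in>P. conn E P v x" "conn E (insert z P) v z"
      by (rule conn_truncate[OF w(3)])
    then show ?thesis
      by (intro exI[of _ "(P, z)"]) auto
  qed
  then obtain r where r: "\<And>v Q. v \<in> B \<Longrightarrow> Q \<in> fan v \<Longrightarrow> ?good v Q (fst (r v Q)) (snd (r v Q))"
    by metis
  define P z where "P v Q = fst (r v Q)" and "z v Q = snd (r v Q)" for v Q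
  have Qv: "Q \<subseteq> V" "card Q \<le> m" "finite Q" if "v \<in> B" "Q \<in> fan v" for v Q
    using fan[of v] that B(1) fin finite_subset[of Q V] by (auto simp: short_link_def)
  have P1: "P v Q \<subseteq> Q - (S \<union> W - {v})" "v \<in> P v Q" and P2: "z v Q \<in> Q" "z v Q \<in> S \<union> W" "z v Q \<noteq> v"
    and P3: "\<And>x. x \<in> P v Q \<Longrightarrow> conn E (P v Q) v x" "conn E (insert (z v Q) (P v Q)) v (z v Q)"
    if "v \<in> B" "Q \<in> fan v" for v Q
    using r[OF that] by (auto simp: P_def z_def)
  have PJ: "P v Q - {v} \<subseteq> V - (S \<union> W)" "card (P v Q - {v}) \<le> m" if "v \<in> B" "Q \<in> fan v" for v Q
  proof -
    show "P v Q - {v} \<subseteq> V - (S \<union> W)"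
      using P1(1)[OF that] Qv(1)[OF that] by blast
    have "card (P v Q - {v}) \<le> card Q"
      using P1(1)[OF that] by (intro card_mono Qv(3)[OF that]) blast
    then show "card (P v Q - {v}) \<le> m"
      using Qv(2)[OF that] by simp
  qed
  have zB: "z v Q \<notin> B" if v: "v \<in> B" and Q: "Q \<in> fan v" for v Q
  proof
    assume z: "z v Q \<in> B"
    have "P v Q - {v} \<union> {v, z v Q} = insert (z v Q) (P v Q)"
      using P1(2)[OF v Q] by blast
    then have "{v, z v Q} \<in> F"
      using joined[of v "z v Q" "P v Q - {v}"] P3(2)[OF v Q] P2(3)[OF v Q] PJ[OF v Q] v z B(1) by auto
    then show False
      using indep[OF v z] by simp
  qed

  let ?T = "Sigma B fan"
  define g where "g t = {fst t, z (fst t) (snd t)}" for t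
  have inj: "inj_on g ?T"
  proof (rule inj_onI)
    fix s t assume st: "s \<in> ?T" "t \<in> ?T" "g s = g t"
    obtain v Q v' Q' where eq: "s = (v, Q)" "t = (v', Q')"
      by (metis surj_pair)
    have v: "v \<in> B" "Q \<in> fan v" "v' \<in> B" "Q' \<in> fan v'"
      using st(1,2) eq by auto
    have "{v, z v Q} = {v', z v' Q'}"
      using st(3) by (simp add: g_def eq)
    then have same: "v' = v" "z v' Q' = z v Q"
      using zB[OF v(1,2)] zB[OF v(3,4)] v by (auto simp: doubleton_eq_iff)
    have "z v Q \<in> Q \<inter> Q'" "z v Q \<noteq> v"
      using P2[OF v(1,2)] P2[OF v(3,4)] same by auto
    then have "Q = Q'"
      using fan[of v] v same B(1) by blast
    then show "s = t"
      using same eq by simp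
  qed
  \<comment> \<open>An edge determines its link because \<open>g\<close> is injective.\<close>
  define L where "L e = (let t = inv_into ?T g e in P (fst t) (snd t) - {fst t})" for e
  have L: "L (g (v, Q)) = P v Q - {v}" if "v \<in> B" "Q \<in> fan v" for v Q
    using inv_into_f_f[OF inj, of "(v, Q)"] that by (simp add: L_def)
  have "topo_model (2 * m) V E (S \<union> W) (g ` ?T) L"
    unfolding topo_model_def
  proof (intro conjI ballI impI)
    fix e assume "e \<in> g ` ?T"
    then obtain v Q where e: "e = g (v, Q)" and v: "v \<in> B" "Q \<in> fan v"
      by auto
    show "L e \<subseteq> V - (S \<union> W)" "card (L e) \<le> 2 * m"
      using PJ[OF v] L[OF v] e by auto
    fix x y assume xy: "x \<in> e" "y \<in> e"
    have un: "L e \<union> e = insert (z v Q) (P v Q)"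
      using L[OF v] e P1(2)[OF v] by (auto simp: g_def)
    have c: "conn E (L e \<union> e) v (z v Q)"
      unfolding un by (rule P3(2)[OF v])
    consider "x = y" | "x = v" "y = z v Q" | "x = z v Q" "y = v"
      using xy e by (auto simp: g_def)
    then show "conn E (L e \<union> e) x y"
      using c conn_sym[OF c] xy by cases (simp_all add: conn_refl)
  next
    fix e f assume "e \<in> g ` ?T" "f \<in> g ` ?T" and ef: "e \<noteq> f"
    then obtain v Q v' Q' where e: "e = g (v, Q)" and v: "v \<in> B" "Q \<in> fan v"
        and f: "f = g (v', Q')" and v': "v' \<in> B" "Q' \<in> fan v'"
      by auto
    show "L e \<inter> L f = {}"
    proof (rule ccontr)
      assume "L e \<inter> L f \<noteq> {}"
      then obtain y where y: "y \<in> P v Q" "y \<noteq> v" "y \<in> P v' Q'" "y \<noteq> v'"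
        using L[OF v] L[OF v'] e f by auto
      show False
      proof (cases "v = v'")
        case True
        then have "Q \<noteq> Q'"
          using ef e f by auto
        then have "Q \<inter> Q' = {v}"
          using fan[of v] v v' True B(1) by blast
        then show False
          using y P1(1)[OF v] P1(1)[OF v'] by blast
      next
        case False
        let ?J = "(P v Q - {v}) \<union> (P v' Q' - {v'})"
        have "conn E (P v Q \<union> P v' Q') v v'"
          by (rule conn_union[OF P3(1)[OF v y(1)] conn_sym[OF P3(1)[OF v' y(3)]]])
        moreover have "P v Q \<union> P v' Q' = ?J \<union> {v, v'}"
          using P1(2)[OF v] P1(2)[OF v'] by blast
        ultimately have c: "conn E (?J \<union> {v, v'}) v v'"
          by simp
        have "card ?J \<le> 2 * m"
          using card_Un_le[of "P v Q - {v}" "P v' Q' - {v'}"] PJ(2)[OF v] PJ(2)[OF v'] by linarith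
        moreover have "?J \<subseteq> V - (S \<union> W)"
          using PJ(1)[OF v] PJ(1)[OF v'] by blast
        ultimately have "{v, v'} \<in> F"
          using joined[OF _ _ False _ _ c] v(1) v'(1) B(1) by blast
        then show False
          using indep[OF v(1) v'(1)] by simp
      qed
    qed
  qed
  moreover have "g ` ?T \<subseteq> [S \<union> W]\<^bsup>2\<^esup>"
    using P2(2,3) B(1) by (fastforce simp: g_def)
  ultimately have "topo_minor (2 * m) V E (S \<union> W) (g ` ?T)"
    using S(1) W unfolding topo_minor_def by blast
  then have "card (g ` ?T) < D * card (S \<union> W)"
    using S(2) by (intro sparse) auto
  also have "\<dots> \<le> D * ((1 + 2 * m * D) * card S)"
    using card_Un_le[of S W] cW by (intro mult_le_mono2) simp
  also have "\<dots> \<le> D * ((1 + 2 * m * D) * (2 * D * card B))"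
    by (intro mult_le_mono2 B(3))
  also have "\<dots> = p * card B"
    unfolding p_def by (simp only: mult_ac)
  also have "\<dots> = card ?T"
    using finB fan B(1) by (subst card_SigmaI) (auto simp: subset_iff)
  also have "\<dots> = card (g ` ?T)"
    using inj by (simp add: card_image)
  finally show False
    by simp
qed

section \<open>Vertex orderings\<close>

lemma ordering_exists:
  assumes "finite S"
    and "\<And>S'. S' \<subseteq> S \<Longrightarrow> S' \<noteq> {} \<Longrightarrow> \<exists>v\<in>S'. P S' v"
  shows "\<exists>xs. distinct xs \<and> set xs = S \<and> (\<forall>i<length xs. P (set (take (Suc i) xs)) (xs ! i))"
  using assms
proof (induction "card S" arbitrary: S)
  case 0
  then show ?case
    by (intro exI[of _ "[]"]) auto
next
  case (Suc n)
  then have "S \<noteq> {}"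
    by auto
  then obtain v where v: "v \<in> S" "P S v"
    using Suc.prems(2) by blast
  have "n = card (S - {v})"
    using Suc.hyps(2) v(1) by simp
  moreover have "finite (S - {v})"
    using Suc.prems(1) by simp
  moreover have "\<exists>v\<in>S'. P S' v" if "S' \<subseteq> S - {v}" "S' \<noteq> {}" for S'
    using Suc.prems(2)[of S'] that by blast
  ultimately obtain xs where xs: "distinct xs" "set xs = S - {v}"
      "\<forall>i<length xs. P (set (take (Suc i) xs)) (xs ! i)"
    using Suc.hyps(1) by blast
  have "P (set (take (Suc i) (xs @ [v]))) ((xs @ [v]) ! i)" if "i < length (xs @ [v])" for i
  proof (cases "i < length xs")
    case True
    then show ?thesis
      using xs(3) by (simp add: nth_append)
  next
    case False
    then have "i = length xs"
      using that by simp
    moreover have "insert v (S - {v}) = S"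
      using v(1) by blast
    ultimately show ?thesis
      using v(2) xs(2) by simp
  qed
  then show ?case
    using xs(1,2) v(1) by (intro exI[of _ "xs @ [v]"]) auto
qed

text \<open>
  The vertices of \<open>S\<close> at which walks with at most \<open>n\<close> edges from \<open>v\<close> can enter \<open>S\<close>.
\<close>

definition first_hits :: "'a set set \<Rightarrow> 'a set \<Rightarrow> 'a set \<Rightarrow> 'a \<Rightarrow> nat \<Rightarrow> 'a set" where
  "first_hits E V S v n = {w \<in> S. \<exists>p. p \<noteq> [] \<and> successively (\<lambda>x y. {x, y} \<in> E) p \<and> hd p = v \<and>
      last p = w \<and> set p \<subseteq> V \<and> set (butlast p) \<inter> S = {} \<and> length p \<le> Suc n}"

lemma first_hits_self:
  assumes "v \<in> S"
  shows "first_hits E V S v n \<subseteq> {v}"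
proof
  fix w assume "w \<in> first_hits E V S v n"
  then obtain p where p: "p \<noteq> []" "hd p = v" "last p = w" "set (butlast p) \<inter> S = {}"
    by (auto simp: first_hits_def)
  then have "p = [v]"
    using assms by (cases p) (auto split: if_splits)
  then show "w \<in> {v}"
    using p by simp
qed

text \<open>
  Let \<open>v\<close> lie outside the prefix \<open>S\<close>. A walk from \<open>v\<close> to \<open>S\<close> meets a vertex that precedes \<open>v\<close> in the
  ordering, and its initial segment up to the first such vertex is a link, so it passes through
  one of at most \<open>h\<close> vertices other than \<open>v\<close>. From there at least one step less remains.
\<close>

lemma card_first_hits_le:
  assumes V: "V = set xs" and h: "h > 0"
    and hit: "\<And>j. j < length xs \<Longrightarrow> \<exists>H. card H \<le> h \<and> hits_links E V (set (take (Suc j) xs)) m (xs ! j) H"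
    and S: "S = set (take i xs)"
  shows "v \<in> V \<Longrightarrow> n < m \<Longrightarrow> card (first_hits E V S v n) \<le> h ^ n"
proof (induction n arbitrary: v)
  case 0
  have "first_hits E V S v 0 \<subseteq> {v}"
    by (auto simp: first_hits_def le_Suc_eq length_Suc_conv)
  then show ?case
    using card_mono[of "{v}"] by force
next
  case (Suc n)
  have finV: "finite V"
    using V by simp
  show ?case
  proof (cases "v \<in> S")
    case True
    then have "card (first_hits E V S v (Suc n)) \<le> card {v}"
      by (intro card_mono first_hits_self) auto
    also have "\<dots> \<le> h ^ Suc n"
      using h by (simp add: Suc_le_eq)
    finally show ?thesis .
  next
    case False
    obtain j where j: "j < length xs" "xs ! j = v"
      using Suc.prems(1) V by (metis in_set_conv_nth)
    have "i \<le> j"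
    proof (rule ccontr)
      assume "\<not> i \<le> j"
      then have "take i xs ! j \<in> set (take i xs)"
        using j(1) by (intro nth_mem) simp
      then show False
        using False S j \<open>\<not> i \<le> j\<close> by simp
    qed
    let ?S' = "set (take (Suc j) xs)"
    have SS': "S \<subseteq> ?S' - {v}"
      using False set_take_subset_set_take[of i "Suc j" xs] \<open>i \<le> j\<close> S by auto
    have vS': "v \<in> ?S'"
      using j by (auto simp: take_Suc_conv_app_nth)
    obtain H where H: "card H \<le> h" "H \<subseteq> V - {v}"
        "\<And>W. short_link E V ?S' m v W \<Longrightarrow> H \<inter> W \<noteq> {}"
      using hit[OF j(1)] j(2) by (auto simp: hits_links_def)
    have "first_hits E V S v (Suc n) \<subseteq> (\<Union>u\<in>H. first_hits E V S u n)"
    proof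
      fix w assume "w \<in> first_hits E V S v (Suc n)"
      then obtain p where w: "w \<in> S" and p: "p \<noteq> []" "successively (\<lambda>x y. {x, y} \<in> E) p" "hd p = v"
          "last p = w" "set p \<subseteq> V" "set (butlast p) \<inter> S = {}" "length p \<le> Suc (Suc n)"
        by (auto simp: first_hits_def)
      have "\<exists>x\<in>set p. x \<in> ?S' - {v}"
        using w p(1,4) SS' last_in_set[of p] by blast
      then obtain ys z zs where s: "p = ys @ z # zs" "z \<in> ?S' - {v}" "\<forall>y\<in>set ys. y \<notin> ?S' - {v}"
        using split_list_first_prop[of p "\<lambda>x. x \<in> ?S' - {v}"] by blast
      let ?q = "ys @ [z]"
      have ys: "ys \<noteq> []"
        using s p(3) by auto
      have "hd ys = v"
        using s p(3) ys by simp
      then have "v \<in> set ys"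
        using ys by (metis hd_in_set)
      have "short_link E V ?S' m v (set ?q)"
        unfolding short_link_def
      proof (intro conjI exI)
        show "set ?q \<subseteq> V"
          using p(5) s(1) by auto
        show "card (set ?q) \<le> m"
          using card_length[of ?q] p(7) s(1) Suc.prems(2) by simp
        show "z \<noteq> v"
          using s(2) by blast
        have "set ys \<inter> ?S' = {v}"
          using s(3) \<open>v \<in> set ys\<close> vS' by blast
        moreover have "set ?q = insert z (set ys)"
          by simp
        ultimately show "set ?q \<inter> ?S' = {v, z}"
          using s(2) by blast
        have "successively (\<lambda>x y. {x, y} \<in> E) ?q"
          using p(2) s(1) by (auto simp: successively_append_iff)
        then have "conn E (set ?q) (hd ?q) z"
          by (intro conn_of_walk) auto
        then show "conn E (set ?q) v z"
          using \<open>hd ys = v\<close> ys by simp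
      qed
      then obtain u where u: "u \<in> H" "u \<in> set ?q"
        using H(3) by blast
      then have "u \<in> set p" "u \<noteq> v"
        using s(1) H(2) by auto
      then obtain p1 p2 where sp: "p = p1 @ u # p2"
        by (meson split_list)
      have "p1 \<noteq> []"
        using sp p(3) \<open>u \<noteq> v\<close> by auto
      then have "length (u # p2) \<le> Suc n"
        using p(7) sp by (cases p1) auto
      moreover have "set (butlast (u # p2)) \<subseteq> set (butlast p)"
        unfolding sp by (auto simp: butlast_append)
      ultimately have "w \<in> first_hits E V S u n"
        using w p sp unfolding first_hits_def
        by (auto simp: successively_append_iff intro!: exI[of _ "u # p2"])
      then show "w \<in> (\<Union>u\<in>H. first_hits E V S u n)"
        using u by blast
    qed
    moreover have "finite (\<Union>u\<in>H. first_hits E V S u n)"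
      by (rule finite_subset[of _ S]) (auto simp: first_hits_def S)
    ultimately have "card (first_hits E V S v (Suc n)) \<le> card (\<Union>u\<in>H. first_hits E V S u n)"
      by (intro card_mono)
    also have "\<dots> \<le> (\<Sum>u\<in>H. card (first_hits E V S u n))"
      using H(2) finV by (intro card_UN_le) (meson Diff_subset finite_subset)
    also have "\<dots> \<le> card H * h ^ n"
      using sum_bounded_above[of H "\<lambda>u. card (first_hits E V S u n)" "h ^ n"] Suc H(2) by auto
    also have "\<dots> \<le> h ^ Suc n"
      using H(1) by simp
    finally show ?thesis .
  qed
qed

section \<open>Counting neighbourhood traces\<close>

definition shatters :: "'a set set \<Rightarrow> 'a set \<Rightarrow> bool" where
  "shatters \<T> Y \<longleftrightarrow> (\<forall>Z\<subseteq>Y. \<exists>T\<in>\<T>. T \<inter> Y = Z)"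

lemma shatters_subset:
  assumes "shatters \<T> Y" "Y' \<subseteq> Y"
  shows "shatters \<T> Y'"
  unfolding shatters_def
proof (intro allI impI)
  fix Z assume Z: "Z \<subseteq> Y'"
  then obtain T where "T \<in> \<T>" "T \<inter> Y = Z"
    using assms unfolding shatters_def by (meson order_trans)
  then have "T \<inter> Y' = Z"
    using Z assms(2) by blast
  then show "\<exists>T\<in>\<T>. T \<inter> Y' = Z"
    using \<open>T \<in> \<T>\<close> by blast
qed

text \<open>
  The lemma of Sauer and Shelah in the form given by Pajor. The family is split according to
  membership of \<open>a\<close>; a set shattered by both halves is shattered by the whole family also
  after adding \<open>a\<close>.
\<close>

lemma card_le_card_shattered:
  assumes "finite X" "\<T> \<subseteq> Pow X"
  shows "card \<T> \<le> card {Y. Y \<subseteq> X \<and> shatters \<T> Y}"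
  using assms
proof (induction X arbitrary: \<T> rule: finite_induct)
  case empty
  then have "\<T> = {} \<or> \<T> = {{}}"
    by auto
  then show ?case
  proof
    assume T: "\<T> = {{}}"
    then have "{Y. Y \<subseteq> {} \<and> shatters \<T> Y} = {{}}"
      by (auto simp: shatters_def)
    then show ?thesis
      using T by simp
  qed simp
next
  case (insert a X)
  define T0 where "T0 = {T \<in> \<T>. a \<notin> T}"
  define T1 where "T1 = (\<lambda>T. T - {a}) ` {T \<in> \<T>. a \<in> T}"
  let ?Sh = "\<lambda>\<T>. {Y. Y \<subseteq> X \<and> shatters \<T> Y}"
  have finT: "finite \<T>"
    using insert by (meson finite_Pow_iff finite_insert finite_subset)
  have sub: "T0 \<subseteq> Pow X" "T1 \<subseteq> Pow X"
    using insert.prems by (auto simp: T0_def T1_def)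
  have finSh: "finite (?Sh \<S>)" for \<S> :: "'a set set"
    using insert.hyps(1) by simp
  have "inj_on (\<lambda>T. T - {a}) {T \<in> \<T>. a \<in> T}"
    by (rule inj_onI) (metis (no_types, lifting) insert_Diff mem_Collect_eq)
  then have "card T1 = card {T \<in> \<T>. a \<in> T}"
    by (simp add: T1_def card_image)
  moreover have "card \<T> = card T0 + card {T \<in> \<T>. a \<in> T}"
  proof -
    have "\<T> = T0 \<union> {T \<in> \<T>. a \<in> T}" "T0 \<inter> {T \<in> \<T>. a \<in> T} = {}"
      by (auto simp: T0_def)
    then show ?thesis
      using finT by (metis (no_types, lifting) card_Un_disjoint finite_Un)
  qed
  ultimately have "card \<T> = card T0 + card T1"
    by simp
  also have "\<dots> \<le> card (?Sh T0) + card (?Sh T1)"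
    using insert.IH[OF sub(1)] insert.IH[OF sub(2)] by linarith
  also have "\<dots> = card (?Sh T0 \<union> ?Sh T1) + card (?Sh T0 \<inter> ?Sh T1)"
    by (rule card_Un_Int[OF finSh finSh])
  also have "card (?Sh T0 \<inter> ?Sh T1) = card (insert a ` (?Sh T0 \<inter> ?Sh T1))"
  proof (rule card_image[symmetric], rule inj_onI)
    fix Y Z assume "Y \<in> ?Sh T0 \<inter> ?Sh T1" "Z \<in> ?Sh T0 \<inter> ?Sh T1" "insert a Y = insert a Z"
    then show "Y = Z"
      using insert.hyps(2) by (metis (no_types, lifting) IntD1 insert_ident mem_Collect_eq subsetD)
  qed
  also have "card (?Sh T0 \<union> ?Sh T1) + card (insert a ` (?Sh T0 \<inter> ?Sh T1))
      = card ((?Sh T0 \<union> ?Sh T1) \<union> insert a ` (?Sh T0 \<inter> ?Sh T1))"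
    using insert.hyps by (intro card_Un_disjoint[symmetric]) (auto intro: finSh)
  also have "\<dots> \<le> card {Y. Y \<subseteq> insert a X \<and> shatters \<T> Y}"
  proof (rule card_mono)
    show "finite {Y. Y \<subseteq> insert a X \<and> shatters \<T> Y}"
      using insert.hyps(1) by simp
    show "(?Sh T0 \<union> ?Sh T1) \<union> insert a ` (?Sh T0 \<inter> ?Sh T1) \<subseteq> {Y. Y \<subseteq> insert a X \<and> shatters \<T> Y}"
    proof
      fix Y assume "Y \<in> (?Sh T0 \<union> ?Sh T1) \<union> insert a ` (?Sh T0 \<inter> ?Sh T1)"
      then consider "Y \<in> ?Sh T0" | "Y \<in> ?Sh T1" | Y' where "Y = insert a Y'" "Y' \<in> ?Sh T0" "Y' \<in> ?Sh T1"
        by blast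
      then show "Y \<in> {Y. Y \<subseteq> insert a X \<and> shatters \<T> Y}"
      proof cases
        case 1
        then have "shatters T0 Y" "Y \<subseteq> X"
          by simp_all
        moreover have "T0 \<subseteq> \<T>"
          by (auto simp: T0_def)
        ultimately have "shatters \<T> Y"
          unfolding shatters_def by (meson subsetD)
        then show ?thesis
          using \<open>Y \<subseteq> X\<close> by blast
      next
        case 2
        have "\<exists>T\<in>\<T>. T \<inter> Y = Z" if "Z \<subseteq> Y" for Z
        proof -
          have "shatters T1 Y"
            using 2 by simp
          then obtain T where "T \<in> T1" "T \<inter> Y = Z"
            using \<open>Z \<subseteq> Y\<close> unfolding shatters_def by meson
          moreover have "a \<notin> Y"
            using 2 insert.hyps(2) by auto
          ultimately show ?thesis
            unfolding T1_def by blast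
        qed
        then have "shatters \<T> Y"
          by (simp add: shatters_def)
        then show ?thesis
          using 2 by blast
      next
        case 3
        have a: "a \<notin> Y'"
          using 3 insert.hyps(2) by auto
        have "\<exists>T\<in>\<T>. T \<inter> Y = Z" if Z: "Z \<subseteq> Y" for Z
        proof (cases "a \<in> Z")
          case False
          then have "Z \<subseteq> Y'"
            using Z 3(1) by blast
          moreover have "shatters T0 Y'"
            using 3(2) by simp
          ultimately obtain T where T: "T \<in> T0" "T \<inter> Y' = Z"
            unfolding shatters_def by meson
          then have "T \<in> \<T>" "T \<inter> Y = Z"
            using 3(1) unfolding T0_def by auto
          then show ?thesis
            by blast
        next
          case True
          have "Z - {a} \<subseteq> Y'"
            using Z 3(1) by blast
          moreover have "shatters T1 Y'"
            using 3(3) by simp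
          ultimately obtain T where T: "T \<in> T1" "T \<inter> Y' = Z - {a}"
            unfolding shatters_def by meson
          then obtain T' where "T' \<in> \<T>" "a \<in> T'" "T = T' - {a}"
            by (auto simp: T1_def)
          then have "T' \<inter> Y = Z"
            using T(2) a True 3(1) by blast
          then show ?thesis
            using \<open>T' \<in> \<T>\<close> by blast
        qed
        then have "shatters \<T> Y"
          by (simp add: shatters_def)
        then show ?thesis
          using 3 by blast
      qed
    qed
  qed
  finally show ?case .
qed

text \<open>
  A subset of size at most \<open>k\<close> is listed by a word of length \<open>k\<close> over \<open>X\<close> with \<open>None\<close> as padding.
\<close>

lemma card_small_subsets_le:
  assumes fin: "finite X"
  shows "card {Y. Y \<subseteq> X \<and> card Y \<le> k} \<le> (card X + 1) ^ k"
proof -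
  let ?L = "{xs. set xs \<subseteq> insert None (Some ` X) \<and> length xs = k}"
  have "{Y. Y \<subseteq> X \<and> card Y \<le> k} \<subseteq> (\<lambda>xs. {x. Some x \<in> set xs}) ` ?L"
  proof
    fix Y assume Y: "Y \<in> {Y. Y \<subseteq> X \<and> card Y \<le> k}"
    then have "finite Y"
      using fin finite_subset by blast
    then obtain ys where ys: "set ys = Y" "distinct ys"
      using finite_distinct_list by blast
    then have "length ys \<le> k"
      using Y distinct_card[OF ys(2)] by simp
    then have "map Some ys @ replicate (k - length ys) None \<in> ?L"
      using ys(1) Y by auto
    moreover have "Y = {x. Some x \<in> set (map Some ys @ replicate (k - length ys) None)}"
      using ys(1) by auto
    ultimately show "Y \<in> (\<lambda>xs. {x. Some x \<in> set xs}) ` ?L"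
      by blast
  qed
  moreover have "finite ?L"
    using fin by (intro finite_lists_length_eq) simp
  ultimately have "card {Y. Y \<subseteq> X \<and> card Y \<le> k} \<le> card ?L"
    by (meson card_image_le card_mono finite_imageI order_trans)
  also have "\<dots> = (card X + 1) ^ k"
    using fin by (subst card_lists_length_eq) (auto simp: card_insert_if card_image)
  finally show ?thesis .
qed

text \<open>
  If the neighbourhoods of \<open>U\<close> shatter \<open>A\<close>, each pair in \<open>A\<close> is the trace of a vertex of \<open>U\<close>.
  These vertices are distinct and subdivide the edges of a clique on \<open>A\<close>.
\<close>

lemma card_traces_le:
  assumes fin: "finite V" and E: "E \<subseteq> [V]\<^bsup>2\<^esup>" and no: "\<not> has_clique_minor 1 t V E"
    and X: "X \<subseteq> V" and U: "U \<subseteq> V - X"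
  shows "card (nb E X ` U) \<le> (card X + 1) ^ t"
proof -
  let ?T = "nb E X ` U"
  have finX: "finite X"
    using X fin by (rule finite_subset)
  have small: "card Y \<le> t" if Y: "Y \<subseteq> X" "shatters ?T Y" for Y
  proof (rule ccontr)
    assume "\<not> card Y \<le> t"
    then obtain A where A: "A \<subseteq> Y" "card A = t"
      by (meson nat_le_linear obtain_subset_with_card_n)
    have sh: "shatters ?T A"
      using Y(2) A(1) by (rule shatters_subset)
    have "\<exists>u\<in>U. nb E X u \<inter> A = e" if "e \<in> [A]\<^bsup>2\<^esup>" for e
      using sh that unfolding shatters_def by (auto simp: nsets_def)
    then obtain u where u: "\<And>e. e \<in> [A]\<^bsup>2\<^esup> \<Longrightarrow> u e \<in> U \<and> nb E X (u e) \<inter> A = e"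
      by metis
    have "topo_model 1 V E A ([A]\<^bsup>2\<^esup>) (\<lambda>e. {u e})"
      unfolding topo_model_def
    proof (intro conjI ballI impI)
      fix e assume e: "e \<in> [A]\<^bsup>2\<^esup>"
      show "{u e} \<subseteq> V - A"
        using u[OF e] U A(1) Y(1) by blast
      fix x y assume xy: "x \<in> e" "y \<in> e"
      have adj: "{u e, w} \<in> E" if "w \<in> e" for w
        using u[OF e] that by (auto simp: nb_def)
      have "conn E ({u e} \<union> e) (u e) w" if "w \<in> e" for w
        using adj[OF that] that by (intro conn_edge) auto
      then show "conn E ({u e} \<union> e) x y"
        using xy conn_sym conn_trans by meson
    next
      fix e f assume ef: "e \<in> [A]\<^bsup>2\<^esup>" "f \<in> [A]\<^bsup>2\<^esup>" "e \<noteq> f"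
      then have "u e \<noteq> u f"
        using u by metis
      then show "{u e} \<inter> {u f} = {}"
        by simp
    qed simp
    then have "topo_minor 1 V E A ([A]\<^bsup>2\<^esup>)"
      using A(1) Y(1) X unfolding topo_minor_def by blast
    moreover have "finite A"
      using A(1) Y(1) finX by (meson finite_subset order_trans)
    ultimately show False
      using no A(2) unfolding has_clique_minor_def by blast
  qed
  have "card ?T \<le> card {Y. Y \<subseteq> X \<and> shatters ?T Y}"
    using nb_subset[of E X] by (intro card_le_card_shattered[OF finX]) auto
  also have "\<dots> \<le> card {Y. Y \<subseteq> X \<and> card Y \<le> t}"
    using small finX by (intro card_mono) auto
  also have "\<dots> \<le> (card X + 1) ^ t"
    by (rule card_small_subsets_le[OF finX])
  finally show ?thesis .
qed

section \<open>Nowhere dense classes exclude shallow clique minors\<close>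

lemma contains_subdivided_clique:
  fixes b :: "nat \<Rightarrow> 'a" and p :: "nat \<Rightarrow> nat \<Rightarrow> 'a list"
  assumes inj: "inj_on b {..<k}" and bV: "b ` {..<k} \<subseteq> verts G"
    and len: "\<And>u v. \<lbrakk>u < v; v < k\<rbrakk> \<Longrightarrow> length (p u v) = c + 2"
    and ends: "\<And>u v. \<lbrakk>u < v; v < k\<rbrakk> \<Longrightarrow> hd (p u v) = b u \<and> last (p u v) = b v"
    and dist: "\<And>u v. \<lbrakk>u < v; v < k\<rbrakk> \<Longrightarrow> distinct (p u v)"
    and pV: "\<And>u v. \<lbrakk>u < v; v < k\<rbrakk> \<Longrightarrow> set (p u v) \<subseteq> verts G"
    and walk: "\<And>u v. \<lbrakk>u < v; v < k\<rbrakk> \<Longrightarrow> successively (\<lambda>x y. {x, y} \<in> edges G) (p u v)"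
    and branch: "\<And>u v. \<lbrakk>u < v; v < k\<rbrakk> \<Longrightarrow> set (p u v) \<inter> b ` {..<k} \<subseteq> {b u, b v}"
    and disj: "\<And>u v u' v'. \<lbrakk>u < v; v < k; u' < v'; v' < k; (u, v) \<noteq> (u', v')\<rbrakk>
      \<Longrightarrow> set (p u v) \<inter> set (p u' v') \<subseteq> b ` {..<k}"
  shows "contains_subgraph G (subdivision c (clique_graph k))"
proof -
  define \<phi> where "\<phi> = case_sum b (\<lambda>(u, v, t). p u v ! t)"
  have nth0: "p u v ! 0 = b u" and nthc: "p u v ! Suc c = b v" if "u < v" "v < k" for u v
  proof -
    have "p u v \<noteq> []"
      using len[OF that] by auto
    then show "p u v ! 0 = b u" "p u v ! Suc c = b v"
      using ends[OF that] len[OF that] by (simp_all add: hd_conv_nth last_conv_nth)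
  qed
  have \<phi>_sv: "\<phi> (subdiv_vertex c u v t) = p u v ! t" if "u < v" "v < k" for u v t
    using nth0[OF that] nthc[OF that] by (simp add: \<phi>_def subdiv_vertex_def)
  have inner: "p u v ! t \<in> set (p u v)" "p u v ! t \<notin> b ` {..<k}"
    if uv: "u < v" "v < k" and t: "1 \<le> t" "t \<le> c" for u v t
  proof -
    show mem: "p u v ! t \<in> set (p u v)"
      using len[OF uv] t by simp
    show "p u v ! t \<notin> b ` {..<k}"
    proof
      assume "p u v ! t \<in> b ` {..<k}"
      then have "p u v ! t = p u v ! 0 \<or> p u v ! t = p u v ! Suc c"
        using branch[OF uv] mem nth0[OF uv] nthc[OF uv] by auto
      then show False
        using t len[OF uv] by (auto simp: nth_eq_iff_index_eq[OF dist[OF uv]])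
    qed
  qed
  let ?H = "subdivision c (clique_graph k)"
  have verts: "(\<exists>i<k. x = Inl i) \<or> (\<exists>u v t. u < v \<and> v < k \<and> 1 \<le> t \<and> t \<le> c \<and> x = Inr (u, v, t))"
    if "x \<in> verts ?H" for x
    using that by (auto simp: subdivision_def clique_graph_def)
  have "inj_on \<phi> (verts ?H)"
  proof (rule inj_onI)
    fix x y assume x: "x \<in> verts ?H" and y: "y \<in> verts ?H" and eq: "\<phi> x = \<phi> y"
    from verts[OF x] show "x = y"
    proof (elim disjE exE conjE)
      fix i assume i: "i < k" "x = Inl i"
      from verts[OF y] show ?thesis
      proof (elim disjE exE conjE)
        fix j assume "j < k" "y = Inl j"
        then show ?thesis
          using i eq inj by (auto simp: \<phi>_def inj_on_def)
      next
        fix u v t assume "u < v" "v < k" "1 \<le> t" "t \<le> c" "y = Inr (u, v, t)"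
        then show ?thesis
          using inner(2)[of u v t] i eq imageI[of i "{..<k}" b] by (auto simp: \<phi>_def)
      qed
    next
      fix u v t assume a: "u < v" "v < k" "1 \<le> t" "t \<le> c" "x = Inr (u, v, t)"
      from verts[OF y] show ?thesis
      proof (elim disjE exE conjE)
        fix j assume "j < k" "y = Inl j"
        then show ?thesis
          using inner(2)[OF a(1-4)] a(5) eq imageI[of j "{..<k}" b] by (auto simp: \<phi>_def)
      next
        fix u' v' t' assume a': "u' < v'" "v' < k" "1 \<le> t'" "t' \<le> c" "y = Inr (u', v', t')"
        have same: "p u v ! t = p u' v' ! t'"
          using eq a(5) a'(5) by (simp add: \<phi>_def)
        then have uv: "(u, v) = (u', v')"
          using disj[OF a(1,2) a'(1,2)] inner[OF a(1-4)] inner(1)[OF a'(1-4)] by auto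
        then have "t = t'"
          using same nth_eq_iff_index_eq[OF dist[OF a(1,2)]] len[OF a(1,2)] a(4) a'(4) by auto
        then show ?thesis
          using uv a(5) a'(5) by simp
      qed
    qed
  qed
  moreover have "\<phi> ` verts ?H \<subseteq> verts G"
  proof
    fix y assume "y \<in> \<phi> ` verts ?H"
    then obtain x where x: "x \<in> verts ?H" "y = \<phi> x"
      by blast
    from verts[OF x(1)] show "y \<in> verts G"
    proof (elim disjE exE conjE)
      fix i assume "i < k" "x = Inl i"
      then show ?thesis
        using bV x(2) by (auto simp: \<phi>_def)
    next
      fix u v t assume a: "u < v" "v < k" "1 \<le> t" "t \<le> c" "x = Inr (u, v, t)"
      then show ?thesis
        using inner(1)[OF a(1-4)] pV[OF a(1,2)] x(2) by (auto simp: \<phi>_def)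
    qed
  qed
  moreover have "\<phi> ` e \<in> edges G" if e: "e \<in> edges ?H" for e
  proof -
    obtain u v t where uv: "u < v" "v < k" "t \<le> c"
        and e': "e = {subdiv_vertex c u v t, subdiv_vertex c u v (Suc t)}"
      using e by (auto simp: subdivision_def clique_graph_def)
    have "{p u v ! t, p u v ! Suc t} \<in> edges G"
      using successively_nth[OF walk[OF uv(1,2)], of t] len[OF uv(1,2)] uv(3) by simp
    then show ?thesis
      by (simp add: e' \<phi>_sv[OF uv(1,2)])
  qed
  ultimately show ?thesis
    unfolding contains_subgraph_def by blast
qed

text \<open>
  Pairs are coloured by the number of inner vertices of their paths. Ramsey's theorem gives a
  large set on which all paths have the same length, hence an exact subdivision.
\<close>

lemma subdivided_clique_of_topo_minor:
  assumes fin: "finite (verts G)" and A: "finite A" "topo_minor s (verts G) (edges G) A ([A]\<^bsup>2\<^esup>)"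
    and ramsey: "partn_lst {..<card A} (map k [0..<Suc s]) 2"
  shows "\<exists>c\<le>s. contains_subgraph G (subdivision c (clique_graph (k c)))"
proof -
  define N where "N = card A"
  obtain I where I: "topo_model s (verts G) (edges G) A ([A]\<^bsup>2\<^esup>) I" and AV: "A \<subseteq> verts G"
    using A(2) by (auto simp: topo_minor_def)
  have I1: "I e \<subseteq> verts G - A" "card (I e) \<le> s" "x \<in> e \<Longrightarrow> y \<in> e \<Longrightarrow> conn (edges G) (I e \<union> e) x y"
    if "e \<in> [A]\<^bsup>2\<^esup>" for e x y
    using that I unfolding topo_model_def by blast+
  have I2: "I e \<inter> I f = {}" if "e \<in> [A]\<^bsup>2\<^esup>" "f \<in> [A]\<^bsup>2\<^esup>" "e \<noteq> f" for e f
    using that I unfolding topo_model_def by blast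
  obtain b where "bij_betw b {0..<card A} A"
    using ex_bij_betw_nat_finite[OF A(1)] by blast
  then have b: "inj_on b {..<N}" "b ` {..<N} = A"
    by (auto simp: bij_betw_def N_def atLeast0LessThan)
  have bA: "b i \<in> A" if "i < N" for i
    using b(2) that by auto
  have pair: "{b i, b j} \<in> [A]\<^bsup>2\<^esup>" if "i < j" "j < N" for i j
    using that b inj_onD[OF b(1), of i j] by auto
  define q where "q i j = (SOME p. p \<noteq> [] \<and> hd p = b i \<and> last p = b j \<and> distinct p \<and>
      set p \<subseteq> I {b i, b j} \<union> {b i, b j} \<and> successively (\<lambda>x y. {x, y} \<in> edges G) p)" for i j
  have q: "q i j \<noteq> [] \<and> hd (q i j) = b i \<and> last (q i j) = b j \<and> distinct (q i j) \<and>
      set (q i j) \<subseteq> I {b i, b j} \<union> {b i, b j} \<and> successively (\<lambda>x y. {x, y} \<in> edges G) (q i j)"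
    if ij: "i < j" "j < N" for i j
  proof -
    have "conn (edges G) (I {b i, b j} \<union> {b i, b j}) (b i) (b j)"
      using I1(3)[OF pair[OF ij]] by blast
    from path_of_conn[OF this] show ?thesis
      unfolding q_def by (rule someI_ex)
  qed
  have len: "2 \<le> length (q i j)" "length (q i j) \<le> s + 2" if ij: "i < j" "j < N" for i j
  proof -
    have ne: "b i \<noteq> b j"
      using ij inj_onD[OF b(1), of i j] by auto
    have "length (q i j) \<noteq> 0"
      using q[OF ij] by simp
    moreover have "length (q i j) \<noteq> 1"
    proof
      assume "length (q i j) = 1"
      then obtain x where "q i j = [x]"
        by (auto simp: length_Suc_conv)
      then show False
        using q[OF ij] ne by auto
    qed
    ultimately show "2 \<le> length (q i j)"
      by linarith
    have finI: "finite (I {b i, b j})"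
      using I1(1)[OF pair[OF ij]] fin by (meson Diff_subset finite_subset)
    have "length (q i j) = card (set (q i j))"
      using q[OF ij] distinct_card by metis
    also have "\<dots> \<le> card (I {b i, b j} \<union> {b i, b j})"
      using q[OF ij] finI by (intro card_mono) auto
    also have "\<dots> \<le> card (I {b i, b j}) + card {b i, b j}"
      by (rule card_Un_le)
    also have "\<dots> \<le> s + 2"
      using I1(2)[OF pair[OF ij]] ne by simp
    finally show "length (q i j) \<le> s + 2" .
  qed
  define f where "f e = length (q (Min e) (Max e)) - 2" for e :: "nat set"
  have f: "f {i, j} = length (q i j) - 2" if "i < j" for i j
    using that by (simp add: f_def)
  have "f \<in> [{..<N}]\<^bsup>2\<^esup> \<rightarrow> {..<length (map k [0..<Suc s])}"
  proof
    fix e assume "e \<in> [{..<N}]\<^bsup>2\<^esup>"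
    then obtain i j where "e = {i, j}" "i < j" "j < N"
      by (elim nsets2_E) (metis insert_commute lessThan_iff linorder_neqE_nat)
    then show "f e \<in> {..<length (map k [0..<Suc s])}"
      using f[of i j] len(2)[of i j] by auto
  qed
  then obtain c H where c: "c < Suc s" and H: "H \<in> [{..<N}]\<^bsup>(k c)\<^esup>" "f ` ([H]\<^bsup>2\<^esup>) \<subseteq> {c}"
    using ramsey unfolding partn_lst_def monochromatic_def N_def[symmetric]
    by (metis (no_types, lifting) add_0 diff_zero length_map length_upt nth_map_upt)
  have finH: "finite H" "card H = k c" "H \<subseteq> {..<N}"
    using H(1) by (auto simp: nsets_def)
  obtain h where h: "bij_betw h {..<card H} H" "strict_mono_on {..<card H} h"
    using ex_bij_betw_strict_mono_card[OF finH(1)] by blast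
  let ?b = "b \<circ> h" and ?p = "\<lambda>u v. q (h u) (h v)"
  have hH: "h i \<in> H" if "i < k c" for i
    using h(1) that finH(2) by (auto simp: bij_betw_def)
  have hlt: "h u < h v" "h v < N" if "u < v" "v < k c" for u v
    using h(2) that finH hH[of v] by (auto simp: strict_mono_on_def)
  have hinj: "inj_on h {..<k c}" "h ` {..<k c} = H"
    using h(1) finH(2) by (auto simp: bij_betw_def)
  have bH: "?b ` {..<k c} \<subseteq> A"
    using hinj(2) finH(3) b(2) by auto
  have inj': "inj_on ?b {..<k c}"
    using hinj finH(3) inj_on_subset[OF b(1)] by (intro comp_inj_on) auto
  have "contains_subgraph G (subdivision c (clique_graph (k c)))"
  proof (rule contains_subdivided_clique[where b = ?b and p = ?p])
    show "inj_on ?b {..<k c}"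
      by (rule inj')
    show "?b ` {..<k c} \<subseteq> verts G"
      using bH AV by blast
  next
    fix u v assume uv: "u < v" "v < k c"
    note uv' = hlt[OF uv]
    have "{h u, h v} \<in> [H]\<^bsup>2\<^esup>"
      using hH[of u] hH[of v] uv uv' by auto
    then have "f {h u, h v} \<in> {c}"
      by (rule subsetD[OF H(2) imageI])
    then have "f {h u, h v} = c"
      by simp
    then show "length (?p u v) = c + 2"
      using f[OF uv'(1)] len(1)[OF uv'] by simp
    show "hd (?p u v) = ?b u \<and> last (?p u v) = ?b v" "distinct (?p u v)"
      "successively (\<lambda>x y. {x, y} \<in> edges G) (?p u v)"
      using q[OF uv'] by simp_all
    have sub: "set (?p u v) \<subseteq> I {?b u, ?b v} \<union> {?b u, ?b v}"
      using q[OF uv'] by simp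
    have IA: "I {?b u, ?b v} \<subseteq> verts G - A"
      using I1(1)[OF pair[OF uv']] by simp
    show "set (?p u v) \<inter> ?b ` {..<k c} \<subseteq> {?b u, ?b v}"
      using sub IA bH by blast
    have "?b u \<in> verts G" "?b v \<in> verts G"
      using bA uv' AV by (auto simp: subset_iff)
    then show "set (?p u v) \<subseteq> verts G"
      using sub IA by blast
  next
    fix u v u' v' assume uv: "u < v" "v < k c" and uv': "u' < v'" "v' < k c" and ne: "(u, v) \<noteq> (u', v')"
    have "{?b u, ?b v} \<noteq> {?b u', ?b v'}"
    proof
      assume "{?b u, ?b v} = {?b u', ?b v'}"
      then have "(u = u' \<and> v = v') \<or> (u = v' \<and> v = u')"
        using inj_onD[OF inj', of u u'] inj_onD[OF inj', of v v'] inj_onD[OF inj', of u v']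
          inj_onD[OF inj', of v u'] uv uv' by (auto simp: doubleton_eq_iff)
      then show False
        using uv uv' ne by auto
    qed
    then have dis: "I {?b u, ?b v} \<inter> I {?b u', ?b v'} = {}"
      using I2 pair[OF hlt[OF uv]] pair[OF hlt[OF uv']] by simp
    have IA: "I {?b u, ?b v} \<inter> A = {}" "I {?b u', ?b v'} \<inter> A = {}"
      using I1(1)[OF pair[OF hlt[OF uv]]] I1(1)[OF pair[OF hlt[OF uv']]] by auto
    have "set (?p u v) \<subseteq> I {?b u, ?b v} \<union> {?b u, ?b v}" "set (?p u' v') \<subseteq> I {?b u', ?b v'} \<union> {?b u', ?b v'}"
      using q[OF hlt[OF uv]] q[OF hlt[OF uv']] by simp_all
    moreover have "?b u \<in> ?b ` {..<k c}" "?b v \<in> ?b ` {..<k c}" "?b u' \<in> ?b ` {..<k c}" "?b v' \<in> ?b ` {..<k c}"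
      using uv uv' by auto
    ultimately show "set (?p u v) \<inter> set (?p u' v') \<subseteq> ?b ` {..<k c}"
      using dis IA bH by blast
  qed
  then show ?thesis
    using c by (intro exI[of _ c]) simp
qed

lemma nowhere_dense_no_shallow_clique:
  assumes "graph_class C" "nowhere_dense_class C"
  shows "\<exists>t. \<forall>G\<in>C. \<not> has_clique_minor s t (verts G) (edges G)"
proof -
  obtain k where k: "\<And>r G. G \<in> C \<Longrightarrow> \<not> contains_subgraph G (subdivision r (clique_graph (k r)))"
    using assms(2) unfolding nowhere_dense_class_def by metis
  obtain N :: nat where N: "partn_lst {..<N} (map k [0..<Suc s]) 2"
    using ramsey_full by blast
  have "\<not> has_clique_minor s N (verts G) (edges G)" if G: "G \<in> C" for G
  proof
    assume "has_clique_minor s N (verts G) (edges G)"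
    then obtain A where A: "card A = N" "finite A" "topo_minor s (verts G) (edges G) A ([A]\<^bsup>2\<^esup>)"
      by (auto simp: has_clique_minor_def)
    have "finite (verts G)"
      using assms(1) G by (simp add: graph_class_def wf_ugraph_def)
    then show False
      using subdivided_clique_of_topo_minor[OF _ A(2,3)] A(1) N k[OF G] by blast
  qed
  then show ?thesis
    by blast
qed

section \<open>The construction sequence of a vertex ordering\<close>

definition width_le :: "'a set \<Rightarrow> nat \<Rightarrow> nat \<Rightarrow> 'a cstate \<Rightarrow> bool" where
  "width_le V r k s \<longleftrightarrow> (\<forall>v\<in>V. card (reachable_parts V r s v) \<le> k)"

definition bounded_step :: "'a set \<Rightarrow> nat \<Rightarrow> nat \<Rightarrow> 'a cstate \<Rightarrow> 'a cstate \<Rightarrow> bool" where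
  "bounded_step V r k s s' \<longleftrightarrow> cstep s s' \<and> width_le V r k s'"

lemma merge_width_le_of_steps:
  assumes steps: "(bounded_step (verts G) r k)\<^sup>*\<^sup>* (init_cstate (verts G)) s"
    and init: "width_le (verts G) r k (init_cstate (verts G))"
    and final: "card (parts s) \<le> 1" "unres s = {}" "pos s = edges G"
  shows "merge_width r G \<le> k"
proof -
  from steps have "\<exists>ss. ss \<noteq> [] \<and> hd ss = init_cstate (verts G) \<and> last ss = s \<and> successively cstep ss \<and>
      (\<forall>s\<in>set ss. width_le (verts G) r k s)"
  proof (induction rule: rtranclp_induct)
    case base
    then show ?case
      using init by (intro exI[of _ "[init_cstate (verts G)]"]) simp
  next
    case (step s s')
    then obtain ss where ss: "ss \<noteq> []" "hd ss = init_cstate (verts G)" "last ss = s"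
        "successively cstep ss" "\<forall>s\<in>set ss. width_le (verts G) r k s"
      by blast
    then show ?case
      using step.hyps(2) unfolding bounded_step_def
      by (intro exI[of _ "ss @ [s']"]) (auto simp: successively_append_iff)
  qed
  then obtain ss where ss: "ss \<noteq> []" "hd ss = init_cstate (verts G)" "last ss = s"
      "successively cstep ss" "\<forall>s\<in>set ss. width_le (verts G) r k s"
    by blast
  then have "construction_sequence G ss"
    using final by (simp add: construction_sequence_def)
  then have "merge_width r G \<le> radius_width r G ss"
    unfolding merge_width_def by (intro Least_le) blast
  also have "\<dots> \<le> k"
    unfolding radius_width_def using ss(5) by (intro Least_le) (simp add: width_le_def)
  finally show ?thesis .
qed

text \<open>
  Non-edges are never resolved before the last step, so the set \<open>F\<close> of resolved edges determines
  the unresolved pairs.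
\<close>

definition lazy_state :: "'a set \<Rightarrow> 'a set set \<Rightarrow> 'a set set \<Rightarrow> 'a cstate" where
  "lazy_state V P F = CState P F {} ([V]\<^bsup>2\<^esup> - F)"

lemma reachable_within_mono:
  "reachable_within (Graph V F) r u v \<Longrightarrow> F \<subseteq> F' \<Longrightarrow> reachable_within (Graph V F') r u v"
  unfolding reachable_within_def path_in_def
  by (auto elim!: successively_mono)

text \<open>
  Each reachable part of \<open>Q\<close> contains a reachable part of \<open>P\<close>. Hence the states between two
  given ones need no separate estimate: it suffices to bound the width for the finest partition
  with the largest set of edges.
\<close>

lemma width_le_coarser:
  assumes ref: "refines V P Q" and fin: "finite V" and F: "F \<subseteq> F'"
    and w: "width_le V r k (lazy_state V P F')"
  shows "width_le V r k (lazy_state V Q F)"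
  unfolding width_le_def
proof
  fix v assume v: "v \<in> V"
  have P: "partition_on V P" and Q: "partition_on V Q" and PQ: "\<And>A. A \<in> P \<Longrightarrow> \<exists>B\<in>Q. A \<subseteq> B"
    using ref by (auto simp: refines_def)
  let ?RP = "reachable_parts V r (lazy_state V P F') v"
  let ?RQ = "reachable_parts V r (lazy_state V Q F) v"
  define \<phi> where "\<phi> A = (SOME B. B \<in> Q \<and> A \<subseteq> B)" for A
  have "?RQ \<subseteq> \<phi> ` ?RP"
  proof
    fix B assume "B \<in> ?RQ"
    then obtain u where B: "B \<in> Q" and u: "u \<in> B" "reachable_within (Graph V F) r v u"
      by (auto simp: reachable_parts_def lazy_state_def)
    then have "u \<in> V"
      using partition_onD1[OF Q] by blast
    then obtain A where A: "A \<in> P" "u \<in> A"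
      using partition_onD1[OF P] by blast
    have "\<exists>B. B \<in> Q \<and> A \<subseteq> B"
      using PQ[OF A(1)] by blast
    then have \<phi>: "\<phi> A \<in> Q \<and> A \<subseteq> \<phi> A"
      unfolding \<phi>_def by (rule someI_ex)
    have "\<phi> A = B"
      using disjointD[OF partition_onD2[OF Q], of "\<phi> A" B] \<phi> B u(1) A(2) by blast
    moreover have "A \<in> ?RP"
      using A reachable_within_mono[OF u(2) F] by (auto simp: reachable_parts_def lazy_state_def)
    ultimately show "B \<in> \<phi> ` ?RP"
      by blast
  qed
  moreover have "finite ?RP"
    using finite_elements[OF fin P] by (simp add: reachable_parts_def lazy_state_def)
  ultimately have "card ?RQ \<le> card ?RP"
    by (meson card_image_le card_mono finite_imageI order_trans)
  then show "card ?RQ \<le> k"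
    using w v unfolding width_le_def by (meson order_trans)
qed

lemma merge_steps:
  assumes "refines V P Q" "finite V" "width_le V r k (lazy_state V P F)"
  shows "(bounded_step V r k)\<^sup>*\<^sup>* (lazy_state V P F) (lazy_state V Q F)"
  using assms
proof (induction "card P" arbitrary: P rule: less_induct)
  case less
  note ref = less.prems(1) and fin = less.prems(2)
  have P: "partition_on V P" and Q: "partition_on V Q"
    using ref by (auto simp: refines_def)
  have finP: "finite P"
    by (rule finite_elements[OF fin P])
  show ?case
  proof (cases "\<exists>A\<in>P. \<exists>B\<in>P. \<exists>Z\<in>Q. A \<noteq> B \<and> A \<union> B \<subseteq> Z")
    case False
    have "\<exists>X\<in>P. Y \<subseteq> X" if Y: "Y \<in> Q" for Y
    proof -
      have p: "partition_on Y {p \<in> P. p \<subseteq> Y}"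
        by (rule refines_obtains_subset[OF ref Y])
      have "Y \<noteq> {}"
        using Y partition_onD3[OF Q] by blast
      then obtain X where X: "X \<in> P" "X \<subseteq> Y"
        using partition_onD1[OF p] by blast
      have "X' = X" if "X' \<in> {p \<in> P. p \<subseteq> Y}" for X'
        using False that X Y by blast
      then have "Y \<subseteq> X"
        using partition_onD1[OF p] by blast
      then show ?thesis
        using X by blast
    qed
    then have "refines V Q P"
      using P Q by (simp add: refines_def)
    then have "P = Q"
      using refines_asym[OF ref] by simp
    then show ?thesis
      by simp
  next
    case True
    then obtain A B Z where AB: "A \<in> P" "B \<in> P" "A \<noteq> B" "Z \<in> Q" "A \<union> B \<subseteq> Z"
      by blast
    define P' where "P' = insert (A \<union> B) (P - {A, B})"
    have dis: "X \<inter> Y = {}" if "X \<in> P" "Y \<in> P" "X \<noteq> Y" for X Y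
      using disjointD[OF partition_onD2[OF P] that] .
    have P': "partition_on V P'"
    proof (rule partition_onI)
      show "\<Union>P' = V"
        using partition_onD1[OF P] AB(1,2) by (auto simp: P'_def)
      show "disjnt X Y" if "X \<in> P'" "Y \<in> P'" "X \<noteq> Y" for X Y
        using that dis AB(1,2) unfolding P'_def disjnt_def by blast
      show "{} \<notin> P'"
        using partition_onD3[OF P] AB(1) by (auto simp: P'_def)
    qed
    have "\<exists>Y\<in>P'. X \<subseteq> Y" if "X \<in> P" for X
      using that by (cases "X = A \<or> X = B") (auto simp: P'_def)
    then have refPP': "refines V P P'"
      using P P' by (simp add: refines_def)
    have "\<exists>Y\<in>Q. X \<subseteq> Y" if "X \<in> P'" for X
    proof (cases "X = A \<union> B")
      case True
      then show ?thesis
        using AB(4,5) by blast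
    next
      case False
      then have "X \<in> P"
        using that by (simp add: P'_def)
      then show ?thesis
        using ref by (simp add: refines_def)
    qed
    then have refP'Q: "refines V P' Q"
      using P' Q by (simp add: refines_def)
    have "card P' < card P"
    proof -
      have "card P' \<le> Suc (card (P - {A, B}))"
        using finP by (simp add: P'_def card_insert_if)
      moreover have "card (P - {A, B}) = card P - 2"
        using AB finP by (simp add: card_Diff_subset)
      moreover have "card {A, B} \<le> card P"
        using AB finP by (intro card_mono) auto
      ultimately show ?thesis
        using AB(3) by simp
    qed
    moreover have w: "width_le V r k (lazy_state V P' F)"
      using width_le_coarser[OF refPP' fin order_refl less.prems(3)] .
    ultimately have "(bounded_step V r k)\<^sup>*\<^sup>* (lazy_state V P' F) (lazy_state V Q F)"
      using less.hyps refP'Q fin by blast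
    moreover have "bounded_step V r k (lazy_state V P F) (lazy_state V P' F)"
      using cstep.merge[OF AB(1-3)] w by (simp add: bounded_step_def lazy_state_def P'_def)
    ultimately show ?thesis
      by (rule converse_rtranclp_into_rtranclp[rotated])
  qed
qed

lemma resolve_steps:
  assumes P: "partition_on V P" and fin: "finite V" and A: "A0 \<in> P" "\<A> \<subseteq> P"
    and w: "width_le V r k (lazy_state V P (F \<union> (\<Union>A\<in>\<A>. [V]\<^bsup>2\<^esup> \<inter> pairs_between A0 A)))"
  shows "(bounded_step V r k)\<^sup>*\<^sup>* (lazy_state V P F)
    (lazy_state V P (F \<union> (\<Union>A\<in>\<A>. [V]\<^bsup>2\<^esup> \<inter> pairs_between A0 A)))"
proof -
  let ?F = "\<lambda>\<A>. F \<union> (\<Union>A\<in>\<A>. [V]\<^bsup>2\<^esup> \<inter> pairs_between A0 A)"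
  have "finite \<A>' \<Longrightarrow> \<A>' \<subseteq> \<A> \<Longrightarrow> (bounded_step V r k)\<^sup>*\<^sup>* (lazy_state V P F) (lazy_state V P (?F \<A>'))" for \<A>'
  proof (induction \<A>' rule: finite_induct)
    case empty
    then show ?case
      by simp
  next
    case (insert A \<A>')
    let ?U = "[V]\<^bsup>2\<^esup> - ?F \<A>'"
    have "cstep (lazy_state V P (?F \<A>'))
        (CState P (?F \<A>' \<union> (?U \<inter> pairs_between A0 A)) {} (?U - pairs_between A0 A))"
      unfolding lazy_state_def using insert.prems A by (intro cstep.resolve_pos) auto
    moreover have "?F \<A>' \<union> (?U \<inter> pairs_between A0 A) = ?F (insert A \<A>')"
      by blast
    moreover have "?U - pairs_between A0 A = [V]\<^bsup>2\<^esup> - ?F (insert A \<A>')"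
      by blast
    ultimately have "cstep (lazy_state V P (?F \<A>')) (lazy_state V P (?F (insert A \<A>')))"
      by (simp only: lazy_state_def)
    moreover have "?F (insert A \<A>') \<subseteq> ?F \<A>"
      using insert.prems by blast
    then have "width_le V r k (lazy_state V P (?F (insert A \<A>')))"
      by (rule width_le_coarser[OF refines_refl[OF P] fin _ w])
    ultimately have "bounded_step V r k (lazy_state V P (?F \<A>')) (lazy_state V P (?F (insert A \<A>')))"
      unfolding bounded_step_def ..
    then show ?case
      using insert by (meson insert_subset rtranclp.rtrancl_into_rtrancl)
  qed
  moreover have "finite \<A>"
    using finite_elements[OF fin P] A(2) finite_subset by blast
  ultimately show ?thesis
    by blast
qed

section \<open>Partitions by traces\<close>

definition trace_class :: "'a set set \<Rightarrow> 'a set \<Rightarrow> 'a set \<Rightarrow> 'a \<Rightarrow> 'a set" where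
  "trace_class E V S u = {w \<in> V - S. nb E S w = nb E S u}"

definition trace_partition :: "'a set set \<Rightarrow> 'a set \<Rightarrow> 'a set \<Rightarrow> 'a set set" where
  "trace_partition E V S = (\<lambda>x. {x}) ` S \<union> trace_class E V S ` (V - S)"

lemma partition_on_trace_partition:
  assumes "S \<subseteq> V"
  shows "partition_on V (trace_partition E V S)"
proof (rule partition_onI)
  show "\<Union>(trace_partition E V S) = V"
    using assms by (auto simp: trace_partition_def trace_class_def)
  show "disjnt X Y" if "X \<in> trace_partition E V S" "Y \<in> trace_partition E V S" "X \<noteq> Y" for X Y
    using that by (auto simp: trace_partition_def trace_class_def disjnt_def)
  show "{} \<notin> trace_partition E V S"
    by (auto simp: trace_partition_def trace_class_def)
qed

lemma nb_insert_eq: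
  assumes "x \<notin> S" "nb E (insert x S) w = nb E (insert x S) u"
  shows "nb E S w = nb E S u"
proof -
  have "nb E S y = nb E (insert x S) y \<inter> S" for y
    by (auto simp: nb_def)
  then show ?thesis
    using assms(2) by simp
qed

lemma refines_trace_partition:
  assumes "S \<subseteq> V" "x \<in> V - S"
  shows "refines V (trace_partition E V (insert x S)) (trace_partition E V S)"
  unfolding refines_def
proof (intro conjI ballI)
  fix X assume "X \<in> trace_partition E V (insert x S)"
  then consider y where "y \<in> S" "X = {y}" | "X = {x}"
    | u where "u \<in> V - insert x S" "X = trace_class E V (insert x S) u"
    by (auto simp: trace_partition_def)
  then show "\<exists>Y\<in>trace_partition E V S. X \<subseteq> Y"
  proof cases
    case 1
    then show ?thesis
      by (auto simp: trace_partition_def)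
  next
    case 2
    then have "X \<subseteq> trace_class E V S x"
      using assms(2) by (simp add: trace_class_def)
    then show ?thesis
      using assms(2) by (auto simp: trace_partition_def)
  next
    case 3
    have "X \<subseteq> trace_class E V S u"
    proof
      fix w assume "w \<in> X"
      then have w: "w \<in> V - S" "nb E (insert x S) w = nb E (insert x S) u"
        using 3(2) by (auto simp: trace_class_def)
      then have "nb E S w = nb E S u"
        using nb_insert_eq[of x S E w u] assms(2) by blast
      then show "w \<in> trace_class E V S u"
        using w(1) by (simp add: trace_class_def)
    qed
    then show ?thesis
      using 3 by (auto simp: trace_partition_def)
  qed
qed (use assms in \<open>auto intro!: partition_on_trace_partition\<close>)

text \<open>
  All vertices of a class have the same neighbours in \<open>insert x S\<close>, in particular \<open>x\<close> is adjacent to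
  all or none of them. Resolving \<open>x\<close> positively with the classes of its neighbours produces
  exactly the edges between \<open>x\<close> and the vertices outside \<open>insert x S\<close>.
\<close>

lemma edges_to_resolve:
  assumes E: "E \<subseteq> [V]\<^bsup>2\<^esup>" and x: "x \<in> V - S"
  defines "\<A> \<equiv> trace_class E V (insert x S) ` {u \<in> V - insert x S. {u, x} \<in> E}"
  shows "induced E (V - insert x S) \<union> (\<Union>A\<in>\<A>. [V]\<^bsup>2\<^esup> \<inter> pairs_between {x} A) = induced E (V - S)"
proof (intro equalityI subsetI)
  fix e assume "e \<in> induced E (V - insert x S) \<union> (\<Union>A\<in>\<A>. [V]\<^bsup>2\<^esup> \<inter> pairs_between {x} A)"
  then show "e \<in> induced E (V - S)"
  proof
    assume "e \<in> induced E (V - insert x S)"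
    then show ?thesis
      by (auto simp: induced_def)
  next
    assume "e \<in> (\<Union>A\<in>\<A>. [V]\<^bsup>2\<^esup> \<inter> pairs_between {x} A)"
    then obtain u a where u: "{u, x} \<in> E" and a: "a \<in> trace_class E V (insert x S) u" "e = {x, a}"
      by (auto simp: \<A>_def pairs_between_def)
    have "x \<in> nb E (insert x S) u"
      using u by (simp add: nb_def)
    then have "x \<in> nb E (insert x S) a"
      using a(1) by (simp add: trace_class_def)
    then have "e \<in> E"
      using a(2) by (simp add: nb_def insert_commute)
    then show ?thesis
      using a x by (auto simp: induced_def trace_class_def)
  qed
next
  fix e assume e: "e \<in> induced E (V - S)"
  then have eE: "e \<in> E" "e \<subseteq> V - S"
    by (auto simp: induced_def)
  show "e \<in> induced E (V - insert x S) \<union> (\<Union>A\<in>\<A>. [V]\<^bsup>2\<^esup> \<inter> pairs_between {x} A)"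
  proof (cases "x \<in> e")
    case False
    then show ?thesis
      using eE by (auto simp: induced_def)
  next
    case True
    obtain p q where "e = {p, q}" "p \<noteq> q"
      using eE(1) E by (metis nsets2_E subsetD)
    then obtain a where a: "e = {x, a}" "a \<noteq> x"
      using True by auto
    then have aV: "a \<in> V - insert x S" "{a, x} \<in> E"
      using eE by (auto simp: insert_commute)
    then have "trace_class E V (insert x S) a \<in> \<A>" "a \<in> trace_class E V (insert x S) a"
      by (auto simp: \<A>_def trace_class_def)
    moreover have "e \<in> [V]\<^bsup>2\<^esup>"
      using eE(1) E by blast
    moreover have "e \<in> pairs_between {x} (trace_class E V (insert x S) a)"
      using a(1) aV by (auto simp: pairs_between_def trace_class_def)
    ultimately show ?thesis
      by blast
  qed
qed

section \<open>Bounding the width\<close>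

text \<open>
  The partition is that of the prefix \<open>insert x S\<close>, while the edges are those resolved for the next
  prefix \<open>S\<close>; this dominates every state between the two. A vertex \<open>u\<close> reached from \<open>v\<close> has all its
  neighbours in \<open>S\<close> among the first hits of \<open>v\<close> at radius \<open>Suc r\<close>. The class of \<open>u\<close> is determined by its
  trace on these and by its adjacency to \<open>x\<close>, which gives the factor 2; the remaining summand 1
  accounts for the part \<open>{x}\<close>.
\<close>

lemma width_le_trace_partition:
  assumes fin: "finite V" and E: "E \<subseteq> [V]\<^bsup>2\<^esup>" and no: "\<not> has_clique_minor 1 t V E"
    and S: "S \<subseteq> V" and x: "x \<in> V - S"
    and hits: "\<And>v. v \<in> V - S \<Longrightarrow> card (first_hits E V S v (Suc r)) \<le> c"
  shows "width_le V r (1 + 2 * (c + 1) ^ t)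
    (lazy_state V (trace_partition E V (insert x S)) (induced E (V - S)))"
  unfolding width_le_def
proof
  fix v assume v: "v \<in> V"
  let ?s = "lazy_state V (trace_partition E V (insert x S)) (induced E (V - S))"
  let ?G = "Graph V (induced E (V - S))"
  have parts: "reachable_parts V r ?s v =
      {A \<in> trace_partition E V (insert x S). \<exists>u\<in>A. reachable_within ?G r v u}"
    by (simp add: reachable_parts_def lazy_state_def)
  have path: "\<exists>p. p \<noteq> [] \<and> set p \<subseteq> V \<and> hd p = v \<and> last p = u \<and> length p \<le> Suc r \<and>
      successively (\<lambda>x y. {x, y} \<in> induced E (V - S)) p" if "reachable_within ?G r v u" for u
    using that unfolding reachable_within_def path_in_def by auto
  show "card (reachable_parts V r ?s v) \<le> 1 + 2 * (c + 1) ^ t"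
  proof (cases "v \<in> S")
    case True
    have "u = v" if u: "reachable_within ?G r v u" for u
    proof -
      obtain p where p: "p \<noteq> []" "hd p = v" "last p = u"
          "successively (\<lambda>x y. {x, y} \<in> induced E (V - S)) p"
        using path[OF u] by blast
      obtain p' where p': "p = v # p'"
        using p(1,2) by (cases p) auto
      then have "p' = []"
        using p(4) True by (auto simp: successively_Cons induced_def)
      then show ?thesis
        using p(3) p' by simp
    qed
    then have "reachable_parts V r ?s v \<subseteq> {{v}}"
      using True unfolding parts by (auto simp: trace_partition_def trace_class_def)
    then have "card (reachable_parts V r ?s v) \<le> card {{v}}"
      by (intro card_mono) auto
    then show ?thesis
      by simp
  next
    case False
    define X where "X = first_hits E V S v (Suc r)"
    define R where "R = {u. reachable_within ?G r v u}"
    have XS: "X \<subseteq> S"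
      by (auto simp: X_def first_hits_def)
    have walk: "\<exists>p. p \<noteq> [] \<and> set p \<subseteq> V - S \<and> hd p = v \<and> last p = u \<and> length p \<le> Suc r \<and>
        successively (\<lambda>x y. {x, y} \<in> E) p" if u: "u \<in> R" for u
    proof -
      obtain p where p: "p \<noteq> []" "set p \<subseteq> V" "hd p = v" "last p = u" "length p \<le> Suc r"
          "successively (\<lambda>x y. {x, y} \<in> induced E (V - S)) p"
        using path u by (auto simp: R_def)
      have "set p \<subseteq> V - S"
      proof
        fix y assume y: "y \<in> set p"
        have "conn (induced E (V - S)) (set p) v y"
          using conn_of_walk[OF p(1,6) y] p(3) by simp
        then have "(\<lambda>a b. a \<in> set p \<and> b \<in> set p \<and> {a, b} \<in> induced E (V - S))\<^sup>*\<^sup>* v y"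
          by (simp add: conn_def)
        then show "y \<in> V - S"
          using v False by (induction rule: rtranclp_induct) (auto simp: induced_def)
      qed
      moreover have "successively (\<lambda>x y. {x, y} \<in> E) p"
        using p(6) by (rule successively_mono) (auto simp: induced_def)
      ultimately show ?thesis
        using p by blast
    qed
    have RV: "R \<subseteq> V - S"
    proof
      fix u assume "u \<in> R"
      from walk[OF this] show "u \<in> V - S"
        using last_in_set by blast
    qed
    have trace: "nb E S u = nb E X u" if u: "u \<in> R" for u
    proof -
      obtain p where p: "p \<noteq> []" "set p \<subseteq> V - S" "hd p = v" "last p = u" "length p \<le> Suc r"
          "successively (\<lambda>x y. {x, y} \<in> E) p"
        using walk[OF u] by blast
      have "y \<in> X" if y: "y \<in> S" "{u, y} \<in> E" for y
        unfolding X_def first_hits_def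
      proof (intro CollectI conjI exI)
        show "successively (\<lambda>x y. {x, y} \<in> E) (p @ [y])"
          using p(1,4,6) y(2) by (simp add: successively_append_iff)
        show "set (p @ [y]) \<subseteq> V"
          using p(2) y(1) S by auto
        show "set (butlast (p @ [y])) \<inter> S = {}"
          using p(2) by auto
      qed (use p y in auto)
      then show ?thesis
        using XS by (auto simp: nb_def)
    qed
    \<comment> \<open>the class of a vertex, recovered from its trace \<open>\<tau>\<close> and its adjacency \<open>\<beta>\<close> to \<open>x\<close>\<close>
    define \<Phi> where "\<Phi> = (\<lambda>(\<tau>, \<beta>). {w \<in> V - insert x S. nb E (insert x S) w = \<tau> \<union> (if \<beta> then {x} else {})})"
    have "reachable_parts V r ?s v \<subseteq> insert {x} (\<Phi> ` (nb E X ` R \<times> UNIV))"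
    proof
      fix A assume "A \<in> reachable_parts V r ?s v"
      then obtain u where A: "A \<in> trace_partition E V (insert x S)" and u: "u \<in> A" "u \<in> R"
        unfolding parts R_def by blast
      have uS: "u \<in> V - S"
        using u(2) RV by blast
      show "A \<in> insert {x} (\<Phi> ` (nb E X ` R \<times> UNIV))"
      proof (cases "u = x")
        case True
        then have "A = {x}"
          using A u(1) uS by (auto simp: trace_partition_def trace_class_def)
        then show ?thesis
          by simp
      next
        case False
        then have "A = trace_class E V (insert x S) u"
          using A u(1) uS by (auto simp: trace_partition_def trace_class_def)
        moreover have "nb E (insert x S) u = nb E X u \<union> (if {u, x} \<in> E then {x} else {})"
          using trace[OF u(2)] by (auto simp: nb_def)
        ultimately have "A = \<Phi> (nb E X u, {u, x} \<in> E)"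
          by (simp add: \<Phi>_def trace_class_def)
        then show ?thesis
          using u(2) by blast
      qed
    qed
    moreover have finR: "finite (nb E X ` R \<times> (UNIV :: bool set))"
      using finite_subset[OF RV] fin by simp
    ultimately have "card (reachable_parts V r ?s v) \<le> card (insert {x} (\<Phi> ` (nb E X ` R \<times> UNIV)))"
      by (intro card_mono) auto
    also have "\<dots> \<le> 1 + card (\<Phi> ` (nb E X ` R \<times> UNIV))"
      using finR by (simp add: card_insert_if)
    also have "card (\<Phi> ` (nb E X ` R \<times> UNIV)) \<le> card (nb E X ` R \<times> (UNIV :: bool set))"
      using finR by (rule card_image_le)
    also have "\<dots> = 2 * card (nb E X ` R)"
      by (simp add: card_cartesian_product)
    also have "card (nb E X ` R) \<le> (card X + 1) ^ t"
      using XS S RV by (intro card_traces_le[OF fin E no]) auto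
    also have "\<dots> \<le> (c + 1) ^ t"
      using hits[of v] v False by (intro power_mono) (auto simp: X_def)
    finally show ?thesis
      by simp
  qed
qed

lemma merge_width_le_of_ordering:
  assumes V: "V = verts G" "V \<noteq> {}" and wf: "wf_ugraph G" and E: "E = edges G"
    and no: "\<not> has_clique_minor 1 t V E"
    and xs: "distinct xs" "set xs = V"
    and hits: "\<And>i v. v \<in> V \<Longrightarrow> card (first_hits E V (set (take i xs)) v (Suc r)) \<le> c"
  shows "merge_width r G \<le> 1 + 2 * (c + 1) ^ t"
proof -
  define k where "k = 1 + 2 * (c + 1) ^ t"
  have fin: "finite V" and E2: "E \<subseteq> [V]\<^bsup>2\<^esup>"
    using wf V E by (auto simp: wf_ugraph_def)
  let ?S = "\<lambda>i. set (take i xs)"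
  let ?st = "\<lambda>i. lazy_state V (trace_partition E V (?S i)) (induced E (V - ?S i))"
  have S: "?S i \<subseteq> V" for i
    using xs(2) set_take_subset by fastforce
  have Suc_S: "?S (Suc i) = insert (xs ! i) (?S i)" "xs ! i \<in> V - ?S i" if "i < length xs" for i
    using that xs by (auto simp: take_Suc_conv_app_nth distinct_conv_nth in_set_conv_nth)
  have wide: "width_le V r k (lazy_state V (trace_partition E V (?S (Suc i))) (induced E (V - ?S i)))"
    if i: "i < length xs" for i
    unfolding k_def Suc_S(1)[OF i]
    using hits by (intro width_le_trace_partition[OF fin E2 no S Suc_S(2)[OF i]]) auto
  have init: "?st (length xs) = init_cstate V"
  proof -
    have "induced E {} = {}"
      using E2 by (auto simp: induced_def nsets_def)
    then show ?thesis
      using xs(2) by (auto simp: lazy_state_def init_cstate_def trace_partition_def)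
  qed
  have stage: "(bounded_step V r k)\<^sup>*\<^sup>* (?st (Suc i)) (?st i)" if i: "i < length xs" for i
  proof -
    let ?x = "xs ! i"
    let ?P = "trace_partition E V (insert ?x (?S i))"
    define \<A> where "\<A> = trace_class E V (insert ?x (?S i)) ` {u \<in> V - insert ?x (?S i). {u, ?x} \<in> E}"
    have res: "induced E (V - insert ?x (?S i)) \<union> (\<Union>A\<in>\<A>. [V]\<^bsup>2\<^esup> \<inter> pairs_between {?x} A)
        = induced E (V - ?S i)"
      unfolding \<A>_def by (rule edges_to_resolve[OF E2 Suc_S(2)[OF i]])
    have w: "width_le V r k (lazy_state V ?P (induced E (V - ?S i)))"
      using wide[OF i] by (simp only: Suc_S(1)[OF i])
    have P: "partition_on V ?P"
      using S[of i] Suc_S(2)[OF i] by (intro partition_on_trace_partition) auto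
    have "\<A> \<subseteq> ?P" "{?x} \<in> ?P"
      by (auto simp: \<A>_def trace_partition_def)
    then have "(bounded_step V r k)\<^sup>*\<^sup>* (lazy_state V ?P (induced E (V - insert ?x (?S i))))
        (lazy_state V ?P (induced E (V - ?S i)))"
      using resolve_steps[OF P fin, of "{?x}" \<A> r k "induced E (V - insert ?x (?S i))"] w
      by (simp only: res)
    moreover have "(bounded_step V r k)\<^sup>*\<^sup>* (lazy_state V ?P (induced E (V - ?S i))) (?st i)"
      by (rule merge_steps[OF refines_trace_partition[OF S Suc_S(2)[OF i]] fin w])
    ultimately show ?thesis
      unfolding Suc_S(1)[OF i] by (rule rtranclp_trans)
  qed
  have "j \<le> length xs \<Longrightarrow> (bounded_step V r k)\<^sup>*\<^sup>* (?st (length xs)) (?st (length xs - j))" for j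
  proof (induction j)
    case (Suc j)
    have "(bounded_step V r k)\<^sup>*\<^sup>* (?st (Suc (length xs - Suc j))) (?st (length xs - Suc j))"
      using Suc.prems by (intro stage) simp
    moreover have "Suc (length xs - Suc j) = length xs - j"
      using Suc.prems by simp
    ultimately have "(bounded_step V r k)\<^sup>*\<^sup>* (?st (length xs - j)) (?st (length xs - Suc j))"
      by simp
    then show ?case
      by (rule rtranclp_trans[OF Suc.IH[OF Suc_leD[OF Suc.prems]]])
  qed simp
  from this[of "length xs"] have steps: "(bounded_step V r k)\<^sup>*\<^sup>* (init_cstate V) (?st 0)"
    using init by simp
  have st0: "?st 0 = CState {V} E {} ([V]\<^bsup>2\<^esup> - E)"
    using V(2) induced_self[OF E2]
    by (auto simp: lazy_state_def trace_partition_def trace_class_def nb_def)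
  define s where "s = CState {V} E ({} \<union> (([V]\<^bsup>2\<^esup> - E) \<inter> pairs_between V V))
      ([V]\<^bsup>2\<^esup> - E - pairs_between V V)"
  have last: "bounded_step V r k (CState {V} E {} ([V]\<^bsup>2\<^esup> - E)) s"
    unfolding bounded_step_def
  proof
    show "cstep (CState {V} E {} ([V]\<^bsup>2\<^esup> - E)) s"
      unfolding s_def by (rule cstep.resolve_neg) auto
    have "card (reachable_parts V r s v) \<le> k" for v
    proof -
      have "card (reachable_parts V r s v) \<le> card {V}"
        by (intro card_mono) (auto simp: reachable_parts_def s_def)
      then show ?thesis
        by (simp add: k_def)
    qed
    then show "width_le V r k s"
      by (simp add: width_le_def)
  qed
  have "(bounded_step V r k)\<^sup>*\<^sup>* (init_cstate V) s"
    using steps last unfolding st0 by (rule rtranclp.rtrancl_into_rtrancl)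
  moreover have "width_le V r k (init_cstate V)"
  proof -
    have n: "length xs - 1 < length xs" "Suc (length xs - 1) = length xs"
      using V(2) xs(2) by (cases xs; simp)+
    have "width_le V r k (?st (length xs))"
    proof (rule width_le_coarser[OF refines_refl fin])
      show "partition_on V (trace_partition E V (?S (length xs)))"
        by (rule partition_on_trace_partition[OF S])
      show "induced E (V - ?S (length xs)) \<subseteq> induced E (V - ?S (length xs - 1))"
        using xs(2) by (intro induced_mono) auto
      show "width_le V r k (lazy_state V (trace_partition E V (?S (length xs)))
          (induced E (V - ?S (length xs - 1))))"
        using wide[OF n(1)] by (simp only: n(2))
    qed
    then show ?thesis
      using init by simp
  qed
  moreover have "unres s = {}"
    by (auto simp: s_def pairs_between_def nsets_2_eq)
  ultimately show ?thesis
    unfolding k_def[symmetric] V(1) by (intro merge_width_le_of_steps) (auto simp: s_def E)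
qed

section \<open>Polynomially small merge-width\<close>

lemma has_clique_minor_compose:
  assumes "topo_minor b V E A F" "has_clique_minor a t A F" "finite V"
  shows "has_clique_minor (a + 2 ^ (a + 2) * b) t V E"
proof -
  obtain B where "card B = t" "finite B" "topo_minor a A F B ([B]\<^bsup>2\<^esup>)"
    using assms(2) by (auto simp: has_clique_minor_def)
  then show ?thesis
    using topo_minor_compose[OF assms(1) _ assms(3)] unfolding has_clique_minor_def by blast
qed

lemma merge_width_empty:
  assumes "wf_ugraph G" "verts G = {}"
  shows "merge_width r G = 0"
proof -
  have "edges G = {}"
    using assms by (auto simp: wf_ugraph_def nsets_def)
  then have "merge_width r G \<le> 0"
    using assms(2)
    by (intro merge_width_le_of_steps[of G r 0 "init_cstate (verts G)"])
      (auto simp: init_cstate_def width_le_def nsets_empty_iff)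
  then show ?thesis
    by simp
qed

lemma merge_width_le_of_sparse_minors:
  assumes wf: "wf_ugraph G" and ne: "verts G \<noteq> {}" and D: "D > 0"
    and no: "\<not> has_clique_minor 1 t (verts G) (edges G)"
    and sparse: "\<And>A F. topo_minor (2 * (r + 2)) (verts G) (edges G) A F \<Longrightarrow> A \<noteq> {} \<Longrightarrow> card F < D * card A"
  shows "merge_width r G \<le> 1 + 2 * ((2 * D * D * (1 + 2 * (r + 2) * D) * (r + 2)) ^ (r + 1) + 1) ^ t"
proof -
  define V E m h where "V = verts G" and "E = edges G" and "m = r + 2"
    and "h = 2 * D * D * (1 + 2 * (r + 2) * D) * (r + 2)"
  have fin: "finite V"
    using wf by (simp add: wf_ugraph_def V_def)
  have "\<exists>v\<in>S. \<exists>H. card H \<le> h \<and> hits_links E V S m v H" if "S \<subseteq> V" "S \<noteq> {}" for S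
    unfolding h_def m_def
    using hitting_set_exists[OF fin _ that, of "r + 2" E D] sparse by (simp add: V_def E_def)
  then obtain xs where xs: "distinct xs" "set xs = V"
      "\<forall>i<length xs. \<exists>H. card H \<le> h \<and> hits_links E V (set (take (Suc i) xs)) m (xs ! i) H"
    using ordering_exists[OF fin, of "\<lambda>S v. \<exists>H. card H \<le> h \<and> hits_links E V S m v H"] by blast
  have "h > 0"
    using D by (simp add: h_def)
  then have "card (first_hits E V (set (take i xs)) v (Suc r)) \<le> h ^ Suc r" if "v \<in> V" for i v
    using xs that by (intro card_first_hits_le[of V xs h E m]) (auto simp: m_def)
  then have "merge_width r G \<le> 1 + 2 * (h ^ Suc r + 1) ^ t"
    using merge_width_le_of_ordering[OF V_def _ wf E_def _ xs(1,2)] ne no by (simp add: V_def E_def)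
  then show ?thesis
    by (simp add: h_def)
qed

lemma bound_le_monomial:
  fixes D m u t :: nat
  assumes "D > 0"
  shows "1 + 2 * ((2 * D * D * (1 + 2 * m * D) * m) ^ u + 1) ^ t
    \<le> (1 + 2 * ((2 * m * (1 + 2 * m)) ^ u + 1) ^ t) * D ^ (3 * u * t)"
proof -
  define a where "a = 2 * m * (1 + 2 * m)"
  have "1 + 2 * m * D \<le> (1 + 2 * m) * D"
    using assms by (simp add: algebra_simps)
  then have "2 * D * D * m * (1 + 2 * m * D) \<le> 2 * D * D * m * ((1 + 2 * m) * D)"
    by (rule mult_le_mono2)
  then have "2 * D * D * (1 + 2 * m * D) * m \<le> a * D ^ 3"
    by (simp only: a_def power3_eq_cube mult_ac)
  then have "(2 * D * D * (1 + 2 * m * D) * m) ^ u \<le> (a * D ^ 3) ^ u"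
    by (rule power_mono) simp
  also have "\<dots> = a ^ u * D ^ (3 * u)"
    by (simp add: power_mult_distrib power_mult)
  finally have "(2 * D * D * (1 + 2 * m * D) * m) ^ u + 1 \<le> a ^ u * D ^ (3 * u) + D ^ (3 * u)"
    using assms by (intro add_mono) (auto simp: Suc_le_eq)
  also have "\<dots> = (a ^ u + 1) * D ^ (3 * u)"
    by simp
  finally have "((2 * D * D * (1 + 2 * m * D) * m) ^ u + 1) ^ t \<le> ((a ^ u + 1) * D ^ (3 * u)) ^ t"
    by (rule power_mono) simp
  also have "\<dots> = (a ^ u + 1) ^ t * D ^ (3 * u * t)"
    by (simp only: power_mult_distrib power_mult)
  finally have "1 + 2 * ((2 * D * D * (1 + 2 * m * D) * m) ^ u + 1) ^ t
      \<le> D ^ (3 * u * t) + 2 * ((a ^ u + 1) ^ t * D ^ (3 * u * t))"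
    using assms by (intro add_mono mult_le_mono2) (auto simp: Suc_le_eq)
  also have "\<dots> = (1 + 2 * (a ^ u + 1) ^ t) * D ^ (3 * u * t)"
    by (simp add: algebra_simps)
  finally show ?thesis
    by (simp only: a_def)
qed

text \<open>
  An integer \<open>q\<close> of order \<open>n powr (1 / l)\<close>. The constant absorbs both rounding up and the lower bound
  \<open>q0\<close>, so that small graphs need no separate treatment.
\<close>

lemma root_exists:
  fixes q0 l n :: nat
  assumes l: "l > 0" and n: "n > 0"
  shows "\<exists>q\<ge>q0. n \<le> q ^ l \<and> real q \<le> real (q0 + 2) * real n powr (1 / real l)"
proof -
  define y where "y = real n powr (1 / real l)"
  define q where "q = max q0 (nat \<lceil>y\<rceil>)"
  have y1: "y \<ge> 1"
    unfolding y_def using n by (intro ge_one_powr_ge_zero) auto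
  have "y ^ l = real n"
    using l n by (simp add: y_def powr_power)
  moreover have "y \<le> real q"
    unfolding q_def using y1 by linarith
  then have "y ^ l \<le> real q ^ l"
    using y1 by (intro power_mono) auto
  ultimately have "real n \<le> real (q ^ l)"
    by simp
  then have "n \<le> q ^ l"
    by (simp only: of_nat_le_iff)
  moreover have "real q \<le> real q0 + (y + 1)"
    unfolding q_def using y1 by linarith
  moreover have "real q0 \<le> real q0 * y"
    using y1 by (simp add: mult_le_cancel_left1)
  ultimately show ?thesis
    using y1 unfolding y_def[symmetric] by (intro exI[of _ q]) (auto simp: q_def algebra_simps)
qed

text \<open>
  The order of choices matters. The exponent \<open>t\<close> comes from excluding cliques subdivided at most
  once, and \<open>k\<close> is chosen large compared with it. Only then is the excluded clique size \<open>t'\<close> fixed for the depth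
  that \<open>k\<close> dictates, and it enters the constant but not the exponent. With \<open>D = q ^ (4 * k + 4)\<close>
  and \<open>q\<close> of order \<open>n powr (1 / l)\<close>, the width is at most a constant times
  \<open>n powr (6 * (r + 1) * t / k)\<close>.
\<close>

theorem theorem1p14:
  fixes C :: "'a ugraph set"
  assumes "graph_class C"
    and "nowhere_dense_class C"
  shows "almost_bounded_merge_width C"
  unfolding almost_bounded_merge_width_def
proof (intro allI impI)
  fix r :: nat and \<epsilon> :: real assume \<epsilon>: "\<epsilon> > 0"
  obtain t where t: "\<And>G. G \<in> C \<Longrightarrow> \<not> has_clique_minor 1 t (verts G) (edges G)"
    using nowhere_dense_no_shallow_clique[OF assms] by blast
  define k where "k = Suc (nat \<lceil>6 * real ((r + 1) * t) / \<epsilon>\<rceil>)"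
  define l where "l = dense_exp k"
  have l: "l > 0" "real l = real k * (2 * real k + 2)"
    by (auto simp: l_def dense_exp_def k_def algebra_simps)
  define a b where "a = 4 * l + 4" and "b = 2 * (r + 2)"
  obtain t' where t': "\<And>G. G \<in> C \<Longrightarrow> \<not> has_clique_minor (a + 2 ^ (a + 2) * b) t' (verts G) (edges G)"
    using nowhere_dense_no_shallow_clique[OF assms] by blast
  define q0 where "q0 = 36 * (t' + 1) ^ 2 * (t' + t' ^ 2 * (4 * dense_exp k + 4) + 1) * 25 ^ k"
  define K where "K = 1 + 2 * ((2 * (r + 2) * (1 + 2 * (r + 2))) ^ (r + 1) + 1) ^ t"
  define e where "e = (4 * k + 4) * (3 * (r + 1) * t)"
  have exp: "real e / real l \<le> \<epsilon>"
  proof -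
    have "6 * real ((r + 1) * t) / \<epsilon> \<le> real k"
      unfolding k_def by linarith
    then have "6 * real ((r + 1) * t) \<le> \<epsilon> * real k"
      using \<epsilon> by (simp add: divide_le_eq mult.commute)
    then have "6 * real ((r + 1) * t) * (2 * real k + 2) \<le> \<epsilon> * real k * (2 * real k + 2)"
      by (intro mult_right_mono) auto
    moreover have "real e = 6 * real ((r + 1) * t) * (2 * real k + 2)"
      by (simp add: e_def algebra_simps)
    ultimately have "real e \<le> \<epsilon> * real l"
      by (simp add: l(2) mult.assoc)
    then show ?thesis
      using l(1) by (simp add: divide_le_eq)
  qed
  show "\<exists>c::real. \<forall>G\<in>C. real (merge_width r G) \<le> c * real (card (verts G)) powr \<epsilon>"
  proof (intro exI ballI)
    fix G assume G: "G \<in> C"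
    have wf: "wf_ugraph G"
      using assms(1) G by (simp add: graph_class_def)
    then have fin: "finite (verts G)"
      by (simp add: wf_ugraph_def)
    let ?n = "card (verts G)"
    show "real (merge_width r G) \<le> (real K * real (q0 + 2) ^ e) * real ?n powr \<epsilon>"
    proof (cases "verts G = {}")
      case True
      then show ?thesis
        using merge_width_empty[OF wf True] by simp
    next
      case False
      then have n: "?n > 0"
        using fin by (simp add: card_gt_0_iff)
      obtain q where q: "q \<ge> q0" "?n \<le> q ^ l" "real q \<le> real (q0 + 2) * real ?n powr (1 / real l)"
        using root_exists[OF l(1) n, of q0] by blast
      have "q \<noteq> 0"
      proof
        assume "q = 0"
        then show False
          using q(2) n l(1) by (simp add: zero_power)
      qed
      define D where "D = q ^ (4 * k + 4)"
      have D: "D > 0"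
        using \<open>q \<noteq> 0\<close> by (simp add: D_def)
      have sparse: "card F < D * card A"
        if AF: "topo_minor (2 * (r + 2)) (verts G) (edges G) A F" and A: "A \<noteq> {}" for A F
      proof (rule ccontr)
        assume "\<not> ?thesis"
        then have dense: "q ^ (4 * k + 4) * card A \<le> card F"
          by (simp add: D_def)
        have AV: "A \<subseteq> verts G" and F: "F \<subseteq> [A]\<^bsup>2\<^esup>"
          using AF by (auto simp: topo_minor_def)
        have finA: "finite A"
          using AV fin by (rule finite_subset)
        have size: "card A \<le> q ^ dense_exp k"
          using card_mono[OF fin AV] q(2) by (simp add: l_def)
        have "k > 0"
          by (simp add: k_def)
        then have "has_clique_minor a t' A F"
          unfolding a_def l_def
          using dense_graph_has_clique_minor[OF _ q(1)[unfolded q0_def] F finA A size dense] by simp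
        then have "has_clique_minor (a + 2 ^ (a + 2) * b) t' (verts G) (edges G)"
          using has_clique_minor_compose[OF AF _ fin] by (simp add: b_def)
        then show False
          using t'[OF G] by simp
      qed
      have "merge_width r G \<le> K * D ^ (3 * (r + 1) * t)"
        using merge_width_le_of_sparse_minors[OF wf False D t[OF G] sparse]
          bound_le_monomial[OF D, of "r + 2" "r + 1" t] unfolding K_def by (rule order_trans)
      also have "D ^ (3 * (r + 1) * t) = q ^ e"
        by (simp only: D_def e_def power_mult)
      finally have "real (merge_width r G) \<le> real (K * q ^ e)"
        by (simp only: of_nat_le_iff)
      also have "\<dots> = real K * real q ^ e"
        by simp
      also have "\<dots> \<le> real K * (real (q0 + 2) * real ?n powr (1 / real l)) ^ e"
        using q(3) by (intro mult_left_mono power_mono) auto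
      also have "\<dots> = (real K * real (q0 + 2) ^ e) * real ?n powr (real e / real l)"
        using n by (simp add: power_mult_distrib powr_power)
      also have "\<dots> \<le> (real K * real (q0 + 2) ^ e) * real ?n powr \<epsilon>"
        using n exp by (intro mult_left_mono powr_mono) auto
      finally show ?thesis .
    qed
  qed
qed

end
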